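(* Let $n\in\mathbb{R}_+^I$, let $\Lambda^*(n)$ be the unique optimizer of the optimization problem described in the context, and let $\mathcal{J}^\circ=\{j\in\mathcal{J}: \sum_{i: j\in i}\Lambda^*_i(n)/\mu_{ji}<1\}$ (the non-bottleneck queues). Let $(u_c)_{c\in\mathbb{N}}$ be any uniformly bounded sequence in $\mathbb{R}^I$ such that $cn+u_c\in\mathbb{Z}_+^I$ for every $c$. Then for every $m^\circ=(m^\circ_{ji}: j\in\mathcal{J}^\circ, i\in\mathcal{I}, j\in i)$ with nonnegative integer entries, $$\pi^\circ(m^\circ\mid cn+u_c)\xrightarrow[c\to\infty]{}\pi^\circ_{\Lambda^*(n)}(m^\circ).$$
   Context: Closed multiclass queueing network: $\mathcal{J}$ is a finite set of queues, $\mathcal{I}$ a finite set of routes, $I=|\mathcal{I}|$; each route $i$ is a subset of $\mathcal{J}$ equipped with a cyclic order $(j^i_1,\dots,j^i_{k_i})$ (each queue visited at most once). For $j\in i$, $\mu_{ji}>0$ is the service rate of route-$i$ customers at queue $j$; queues serve at unit rate under processor sharing with exponential service requirements. A state is $m=(m_{ji}: i\in\mathcal{I}, j\in i)$ with nonnegative integer entries, $m_{ji}$ being the number of route-$i$ customers at queue $j$, and $m_j=\sum_{i: j\in i}m_{ji}$. For $n\in\mathbb{Z}_+^I$ let $\mathcal{S}(n)=\{m: \sum_{j\in i}m_{ji}=n_i\ \forall i\}$. The stationary distribution of the network with population vector $n$ is $$\pi(m\mid n)=\frac{1}{B(n)}\prod_{j\in\mathcal{J}}\Big(\frac{m_j!}{\prod_{i: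 j\in i}m_{ji}!}\prod_{i: j\in i}\mu_{ji}^{-m_{ji}}\Big),\quad m\in\mathcal{S}(n),$$ with $B(n)$ the normalizing constant making this a probability distribution. For $n\in\mathbb{R}_+^I$, $\Lambda^*(n)$ is the unique optimizer of: maximize $\sum_{i\in\mathcal{I}}n_i\log\Lambda_i$ subject to $\sum_{i: j\in i}\Lambda_i/\mu_{ji}\le 1$ for all $j\in\mathcal{J}$, over $\Lambda_i\ge0$. With $\bar{\mathcal{J}}=\mathcal{J}\setminus\mathcal{J}^\circ$, the marginal of the non-bottleneck queues is $\pi^\circ(m^\circ\mid n)=\sum_{\bar m}\pi((\bar m,m^\circ)\mid n)$, the sum over all $\bar m=(\bar m_{ji}: j\in\bar{\mathcal{J}}, j\in i)$ with $(\bar m,m^\circ)\in\mathcal{S}(n)$. For $\Lambda\in\mathbb{R}_+^I$, $$\pi^\circ_\Lambda(m^\circ)=\prod_{j\in\mathcal{J}^\circ}\Big(1-\sum_{i: j\in i}\frac{\Lambda_i}{\mu_{ji}}\Big)\frac{m^\circ_j!}{\prod_{i: j\in i}m^\circ_{ji}!}\prod_{i: j\in i}\Big(\frac{\Lambda_i}{\mu_{ji}}\Big)^{m^\circ_{ji}},$$ the stationary distribution of an open product-form network on $\mathcal{J}^\circ$ with Poisson arrivals of rate $\Lambda_i$ on each route. *)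

theory Defs
  imports Complex_Main
begin

text \<open>Queues are the elements of a finite type 'j (so the set of queues is UNIV),
routes the elements of a finite type 'i.  R j i means "queue j lies on route i".
A state m assigns to each pair (j,i) a number m j i; it is required to vanish
outside the pairs with R j i.\<close>

definition states :: "('j::finite \<Rightarrow> 'i::finite \<Rightarrow> bool) \<Rightarrow> ('i \<Rightarrow> nat) \<Rightarrow> ('j \<Rightarrow> 'i \<Rightarrow> nat) set" where
  "states R N = {m. (\<forall>j i. \<not> R j i \<longrightarrow> m j i = 0) \<and> (\<forall>i. (\<Sum>j\<in>UNIV. m j i) = N i)}"

definition weight :: "('j::finite \<Rightarrow> 'i::finite \<Rightarrow> bool) \<Rightarrow> ('j \<Rightarrow> 'i \<Rightarrow> real) \<Rightarrow> ('j \<Rightarrow> 'i \<Rightarrow> nat) \<Rightarrow> real" where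
  "weight R mu m = (\<Prod>j\<in>UNIV.
      (fact (\<Sum>i\<in>{i. R j i}. m j i) / (\<Prod>i\<in>{i. R j i}. fact (m j i)))
      * (\<Prod>i\<in>{i. R j i}. (1 / mu j i) ^ m j i))"

definition normconst :: "('j::finite \<Rightarrow> 'i::finite \<Rightarrow> bool) \<Rightarrow> ('j \<Rightarrow> 'i \<Rightarrow> real) \<Rightarrow> ('i \<Rightarrow> nat) \<Rightarrow> real" where
  "normconst R mu N = (\<Sum>m\<in>states R N. weight R mu m)"

definition closed_pi :: "('j::finite \<Rightarrow> 'i::finite \<Rightarrow> bool) \<Rightarrow> ('j \<Rightarrow> 'i \<Rightarrow> real) \<Rightarrow> ('i \<Rightarrow> nat) \<Rightarrow> ('j \<Rightarrow> 'i \<Rightarrow> nat) \<Rightarrow> real" where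
  "closed_pi R mu N m = weight R mu m / normconst R mu N"

definition marginal_pi :: "('j::finite \<Rightarrow> 'i::finite \<Rightarrow> bool) \<Rightarrow> ('j \<Rightarrow> 'i \<Rightarrow> real) \<Rightarrow> 'j set \<Rightarrow> ('i \<Rightarrow> nat) \<Rightarrow> ('j \<Rightarrow> 'i \<Rightarrow> nat) \<Rightarrow> real" where
  "marginal_pi R mu Jo N mo =
     (\<Sum>m\<in>{m\<in>states R N. \<forall>j\<in>Jo. \<forall>i. m j i = mo j i}. closed_pi R mu N m)"

definition open_pi :: "('j::finite \<Rightarrow> 'i::finite \<Rightarrow> bool) \<Rightarrow> ('j \<Rightarrow> 'i \<Rightarrow> real) \<Rightarrow> 'j set \<Rightarrow> ('i \<Rightarrow> real) \<Rightarrow> ('j \<Rightarrow> 'i \<Rightarrow> nat) \<Rightarrow> real" where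
  "open_pi R mu Jo Lam mo = (\<Prod>j\<in>Jo.
      (1 - (\<Sum>i\<in>{i. R j i}. Lam i / mu j i))
      * (fact (\<Sum>i\<in>{i. R j i}. mo j i) / (\<Prod>i\<in>{i. R j i}. fact (mo j i)))
      * (\<Prod>i\<in>{i. R j i}. (Lam i / mu j i) ^ mo j i))"

definition feasible :: "('j::finite \<Rightarrow> 'i::finite \<Rightarrow> bool) \<Rightarrow> ('j \<Rightarrow> 'i \<Rightarrow> real) \<Rightarrow> ('i \<Rightarrow> real) \<Rightarrow> bool" where
  "feasible R mu Lam \<longleftrightarrow> (\<forall>i. 0 \<le> Lam i) \<and> (\<forall>j. (\<Sum>i\<in>{i. R j i}. Lam i / mu j i) \<le> 1)"

text \<open>Optimizer of: maximize sum n_i log Lam_i over the feasible set, with the usual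
extended-real conventions (0 * log 0 = 0, n_i log 0 = -infinity if n_i > 0): a
feasible point with Lam_i = 0 for some n_i > 0 has value -infinity and is never optimal,
so it suffices to compare with feasible points positive wherever n is.\<close>
definition is_optimizer :: "('j::finite \<Rightarrow> 'i::finite \<Rightarrow> bool) \<Rightarrow> ('j \<Rightarrow> 'i \<Rightarrow> real) \<Rightarrow> ('i \<Rightarrow> real) \<Rightarrow> ('i \<Rightarrow> real) \<Rightarrow> bool" where
  "is_optimizer R mu n Lam \<longleftrightarrow> feasible R mu Lam \<and> (\<forall>i. 0 < n i \<longrightarrow> 0 < Lam i) \<and>
     (\<forall>L. feasible R mu L \<and> (\<forall>i. 0 < n i \<longrightarrow> 0 < L i) \<longrightarrow>
        (\<Sum>i\<in>UNIV. n i * ln (L i)) \<le> (\<Sum>i\<in>UNIV. n i * ln (Lam i)))"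

definition nonbottleneck :: "('j::finite \<Rightarrow> 'i::finite \<Rightarrow> bool) \<Rightarrow> ('j \<Rightarrow> 'i \<Rightarrow> real) \<Rightarrow> ('i \<Rightarrow> real) \<Rightarrow> 'j set" where
  "nonbottleneck R mu Lam = {j. (\<Sum>i\<in>{i. R j i}. Lam i / mu j i) < 1}"

end

theory Submission
  imports Defs "HOL-Library.FuncSet"
begin

text \<open>
  Write \<open>B\<close> for the normalizing constant and \<open>e\<^sub>i\<close> for a unit vector. Everything follows from
  \<open>B (N - e\<^sub>i) / B N \<longrightarrow> Lam i\<close> along populations \<open>N\<close> at bounded distance from \<open>c n\<close>. Indeed, removing a
  customer from queue \<open>j\<close> shows that the constant of the states with \<open>j\<close> empty is
  \<open>B N - (\<Sum>i. B (N - e\<^sub>i) / mu j i)\<close>; emptying the non-bottleneck queues one at a time expresses the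
  marginal as a finite combination of shifted constants, hence its limit as a product.

  The same identity shows that the throughputs \<open>B (N - e\<^sub>i) / B N\<close> form a feasible point of the
  optimization problem. Comparing with the optimizer, \<open>excess N = ln (B N) + (\<Sum>i. N i * ln (Lam i))\<close>
  is superharmonic for the walk that removes a customer of route \<open>i\<close> with probability proportional
  to \<open>n i\<close>, and a quadratic barrier turns this into \<open>excess N \<ge> - o(c)\<close>. On the other hand an
  exponentially tilted multinomial bound shows that states in which \<open>m j i\<close> deviates from
  \<open>Lam i / mu j i * m\<^sub>j\<close> by more than \<open>\<epsilon> c\<close> have exponentially small weight, so that these deviations are
  \<open>o(c)\<close> in mean.

  Finally, adding a customer of route \<open>i\<close> to queue \<open>j\<close> with probability \<open>m j i / N i\<close> writes the
  throughput as the mean of \<open>(\<Sum>j. mu j i * (m j i / m\<^sub>j) * (m j i - 1)) / (N i - 1)\<close>, which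
  concentrates at \<open>Lam i\<close> even if the split of the customers among the bottlenecks does not concentrate.
  Routes with \<open>n i = 0\<close> are handled by capacity: uniqueness of the optimizer forces them through a
  saturated queue.
\<close>

subsection \<open>Estimates on real numbers\<close>

lemma multinomial_term_le:
  fixes y :: "'a \<Rightarrow> real" and x :: "'a \<Rightarrow> nat"
  assumes "finite I" and "\<And>i. i \<in> I \<Longrightarrow> 0 \<le> y i"
  shows "fact (\<Sum>i\<in>I. x i) / (\<Prod>i\<in>I. fact (x i)) * (\<Prod>i\<in>I. y i ^ x i)
    \<le> (\<Sum>i\<in>I. y i) ^ (\<Sum>i\<in>I. x i)"
  using assms
proof (induction I rule: finite_induct)
  case empty
  then show ?case by simp
next
  case (insert a F)
  let ?s = "\<Sum>i\<in>F. x i" and ?Y = "\<Sum>i\<in>F. y i"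
  have Y: "0 \<le> ?Y" and ya: "0 \<le> y a"
    using insert.prems by (auto intro: sum_nonneg)
  have "real (x a + ?s choose x a) * y a ^ x a * ?Y ^ (x a + ?s - x a) \<le> (y a + ?Y) ^ (x a + ?s)"
    unfolding binomial_ring
    by (rule member_le_sum) (use Y ya in auto)
  then have binom: "fact (x a + ?s) / (fact (x a) * fact ?s) * y a ^ x a * ?Y ^ ?s
      \<le> (y a + ?Y) ^ (x a + ?s)"
    by (simp add: binomial_fact)
  have "fact (\<Sum>i\<in>insert a F. x i) / (\<Prod>i\<in>insert a F. fact (x i)) * (\<Prod>i\<in>insert a F. y i ^ x i)
      = fact (x a + ?s) / (fact (x a) * fact ?s) * y a ^ x a *
        (fact ?s / (\<Prod>i\<in>F. fact (x i)) * (\<Prod>i\<in>F. y i ^ x i))"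
    using insert.hyps by simp
  also have "\<dots> \<le> fact (x a + ?s) / (fact (x a) * fact ?s) * y a ^ x a * ?Y ^ ?s"
    using insert ya by (intro mult_left_mono) auto
  finally show ?case
    using binom insert.hyps by simp
qed

lemma exp_le_quadratic:
  fixes x :: real
  assumes "\<bar>x\<bar> \<le> 1"
  shows "exp x \<le> 1 + x + x\<^sup>2"
proof (cases "0 \<le> x")
  case True
  then show ?thesis
    using assms by (intro exp_bound) auto
next
  case False
  have "x * x\<^sup>2 \<le> 0"
    using False by (simp add: mult_nonpos_nonneg)
  then have "1 \<le> (1 - x) * (1 + x + x\<^sup>2)"
    by (simp add: algebra_simps power2_eq_square)
  also have "\<dots> \<le> exp (- x) * (1 + x + x\<^sup>2)"
  proof (rule mult_right_mono)
    show "1 - x \<le> exp (- x)"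
      using exp_ge_add_one_self[of "- x"] by simp
    show "0 \<le> 1 + x + x\<^sup>2"
      using assms by simp
  qed
  finally show ?thesis
    by (simp add: exp_minus field_simps)
qed

lemma power_times_exp_neg_tendsto_0:
  fixes C \<eta> :: real
  assumes "0 < \<eta>"
  shows "(\<lambda>c. (C * real c) ^ d * exp (- \<eta> * real c)) \<longlonglongrightarrow> 0"
proof -
  have "filterlim (\<lambda>c. \<eta> * real c) at_top sequentially"
    using assms filterlim_real_sequentially
    by (intro filterlim_tendsto_pos_mult_at_top[OF tendsto_const]) auto
  then have "(\<lambda>c. (\<eta> * real c) ^ d / exp (\<eta> * real c)) \<longlonglongrightarrow> 0"
    by (rule filterlim_compose[OF tendsto_power_div_exp_0])
  then have "(\<lambda>c. (C / \<eta>) ^ d * ((\<eta> * real c) ^ d / exp (\<eta> * real c))) \<longlonglongrightarrow> 0"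
    by (rule tendsto_mult_right_zero)
  moreover have "(C / \<eta>) ^ d * ((\<eta> * real c) ^ d / exp (\<eta> * real c)) = (C * real c) ^ d * exp (- \<eta> * real c)" for c
    using assms by (simp add: power_mult_distrib power_divide exp_minus field_simps)
  ultimately show ?thesis by simp
qed

lemma real_null_comparison:
  fixes f g :: "nat \<Rightarrow> real"
  assumes "eventually (\<lambda>c. \<bar>f c\<bar> \<le> g c) sequentially" and "g \<longlonglongrightarrow> 0"
  shows "f \<longlonglongrightarrow> 0"
  by (rule tendsto_0_le[OF assms(2), where K = 1])
    (use assms(1) in \<open>eventually_elim, simp\<close>)

subsection \<open>Normalizing constants and throughputs\<close>

definition add_customer :: "('j \<Rightarrow> 'i \<Rightarrow> nat) \<Rightarrow> 'j \<Rightarrow> 'i \<Rightarrow> 'j \<Rightarrow> 'i \<Rightarrow> nat" where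
  "add_customer m j i = m(j := (m j)(i := Suc (m j i)))"

definition remove_customer :: "('j \<Rightarrow> 'i \<Rightarrow> nat) \<Rightarrow> 'j \<Rightarrow> 'i \<Rightarrow> 'j \<Rightarrow> 'i \<Rightarrow> nat" where
  "remove_customer m j i = m(j := (m j)(i := m j i - 1))"

lemma remove_add_customer [simp]: "remove_customer (add_customer m j i) j i = m"
  by (simp add: remove_customer_def add_customer_def)

lemma add_remove_customer [simp]:
  "m j i \<noteq> 0 \<Longrightarrow> add_customer (remove_customer m j i) j i = m"
  by (simp add: remove_customer_def add_customer_def)

lemma sum_add_customer:
  fixes m :: "'j::finite \<Rightarrow> 'i \<Rightarrow> nat"
  shows "(\<Sum>j'\<in>UNIV. add_customer m j i j' i') = (\<Sum>j'\<in>UNIV. m j' i') + of_bool (i' = i)"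
proof -
  have "add_customer m j i j' i' = m j' i' + (if j' = j then of_bool (i' = i) else 0)" for j'
    by (simp add: add_customer_def)
  then show ?thesis
    by (simp add: sum.distrib)
qed

lemma add_customer_in_states_iff:
  assumes "R j i"
  shows "add_customer m j i \<in> states R (N(i := Suc (N i))) \<longleftrightarrow> m \<in> states R N"
proof -
  have "add_customer m j i j' i' = m j' i'" if "\<not> R j' i'" for j' i'
    using assms that by (cases "j' = j"; cases "i' = i") (simp_all add: add_customer_def)
  then have 1: "(\<forall>j' i'. \<not> R j' i' \<longrightarrow> add_customer m j i j' i' = 0) \<longleftrightarrow> (\<forall>j' i'. \<not> R j' i' \<longrightarrow> m j' i' = 0)"
    by metis
  have 2: "(\<Sum>j'\<in>UNIV. m j' i') + of_bool (i' = i) = (N(i := Suc (N i))) i' \<longleftrightarrow> (\<Sum>j'\<in>UNIV. m j' i') = N i'" for i'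
    by simp
  show ?thesis
    unfolding states_def mem_Collect_eq sum_add_customer 1 2 ..
qed

lemma states_le:
  assumes "m \<in> states R N"
  shows "m j i \<le> N i"
proof -
  have "m j i \<le> (\<Sum>j\<in>UNIV. m j i)"
    by (rule member_le_sum) auto
  then show ?thesis
    using assms by (simp add: states_def)
qed

lemma states_bounded_by_total:
  assumes "m \<in> states R N"
  shows "m j i \<le> (\<Sum>i\<in>UNIV. N i)"
  by (rule order_trans[OF states_le[OF assms]], rule member_le_sum) auto

lemma queue_length_le_total:
  assumes "m \<in> states R N"
  shows "(\<Sum>i\<in>{i. R j i}. m j i) \<le> (\<Sum>i\<in>UNIV. N i)"
proof -
  have "(\<Sum>i\<in>{i. R j i}. m j i) \<le> (\<Sum>i\<in>UNIV. m j i)"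
    by (rule sum_mono2) auto
  also have "\<dots> \<le> (\<Sum>i\<in>UNIV. N i)"
    by (rule sum_mono) (rule states_le[OF assms])
  finally show ?thesis .
qed

lemma finite_states_card:
  fixes R :: "'j::finite \<Rightarrow> 'i::finite \<Rightarrow> bool"
  shows "finite (states R N)"
    and "card (states R N) \<le> ((\<Sum>i\<in>UNIV. N i) + 1) ^ card (UNIV :: ('j \<times> 'i) set)"
proof -
  let ?M = "\<Sum>i\<in>UNIV. N i"
  let ?P = "PiE (UNIV :: ('j \<times> 'i) set) (\<lambda>_. {..?M})"
  have fin: "finite ?P"
    by (rule finite_PiE) auto
  have inj: "inj_on case_prod (states R N)"
    by (metis curry_case_prod inj_onI)
  have sub: "case_prod ` states R N \<subseteq> ?P"
    using states_bounded_by_total by fastforce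
  show "finite (states R N)"
    using finite_imageD[OF finite_subset[OF sub fin] inj] .
  have "card (states R N) = card (case_prod ` states R N)"
    by (rule card_image[OF inj, symmetric])
  also have "\<dots> \<le> card ?P"
    by (rule card_mono[OF fin sub])
  also have "\<dots> = (?M + 1) ^ card (UNIV :: ('j \<times> 'i) set)"
    by (simp add: card_PiE)
  finally show "card (states R N) \<le> (?M + 1) ^ card (UNIV :: ('j \<times> 'i) set)" .
qed

locale queueing_network =
  fixes R :: "'j::finite \<Rightarrow> 'i::finite \<Rightarrow> bool" and mu :: "'j \<Rightarrow> 'i \<Rightarrow> real"
  assumes route_nonempty: "\<exists>j. R j i"
    and mu_pos: "R j i \<Longrightarrow> 0 < mu j i"
begin

abbreviation B :: "('i \<Rightarrow> nat) \<Rightarrow> real" where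
  "B \<equiv> normconst R mu"

definition queue_length :: "('j \<Rightarrow> 'i \<Rightarrow> nat) \<Rightarrow> 'j \<Rightarrow> nat" where
  "queue_length m j = (\<Sum>i\<in>{i. R j i}. m j i)"

definition queue_weight :: "'j \<Rightarrow> ('i \<Rightarrow> nat) \<Rightarrow> real" where
  "queue_weight j x = (fact (\<Sum>i\<in>{i. R j i}. x i) / (\<Prod>i\<in>{i. R j i}. fact (x i)))
      * (\<Prod>i\<in>{i. R j i}. (1 / mu j i) ^ x i)"

lemma weight_eq: "weight R mu m = (\<Prod>j\<in>UNIV. queue_weight j (m j))"
  by (simp add: weight_def queue_weight_def)

lemma queue_weight_pos: "0 < queue_weight j x"
  unfolding queue_weight_def by (intro mult_pos_pos divide_pos_pos prod_pos) (auto simp: mu_pos)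

lemma weight_pos: "0 < weight R mu m"
  unfolding weight_eq by (intro prod_pos) (simp add: queue_weight_pos)

lemma queue_weight_Suc:
  assumes "R j i"
  shows "queue_weight j (x(i := Suc (x i))) * mu j i * Suc (x i)
    = queue_weight j x * Suc (\<Sum>i\<in>{i. R j i}. x i)"
proof -
  let ?I = "{i. R j i} - {i}"
  have S: "(\<Sum>k\<in>{i. R j i}. f k) = f i + (\<Sum>k\<in>?I. f k)" for f :: "'i \<Rightarrow> nat"
    using assms by (intro sum.remove) auto
  have P: "(\<Prod>k\<in>{i. R j i}. f k) = f i * (\<Prod>k\<in>?I. f k)" for f :: "'i \<Rightarrow> real"
    using assms by (intro prod.remove) auto
  have c1: "(\<Sum>k\<in>?I. (x(i := Suc (x i))) k) = (\<Sum>k\<in>?I. x k)"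
    by (rule sum.cong) auto
  have c2: "(\<Prod>k\<in>?I. fact ((x(i := Suc (x i))) k)) = (\<Prod>k\<in>?I. fact (x k) :: real)"
    by (rule prod.cong) auto
  have c3: "(\<Prod>k\<in>?I. (1 / mu j k) ^ (x(i := Suc (x i))) k) = (\<Prod>k\<in>?I. (1 / mu j k) ^ x k)"
    by (rule prod.cong) auto
  have gen: "(v * f) / ((w * g) * F) * ((q * p) * G) * r * w = f / (g * F) * (p * G) * v"
    if "q * r = 1" "w \<noteq> 0" for v f w g F q p G r :: real
  proof -
    have "(v * f) / ((w * g) * F) * ((q * p) * G) * r * w
        = (f / (g * F) * (p * G) * v) * (q * r) * (w / w)"
      by simp
    then show ?thesis
      using that by simp
  qed
  show ?thesis
    unfolding queue_weight_def S P c1 c2 c3 fun_upd_same add_Suc fact_Suc power_Suc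
    by (rule gen) (use mu_pos[OF assms] in auto)
qed

lemma weight_add_customer:
  assumes "R j i"
  shows "weight R mu (add_customer m j i) * mu j i * Suc (m j i)
    = weight R mu m * Suc (queue_length m j)"
proof -
  have "weight R mu m' = queue_weight j (m' j) * (\<Prod>k\<in>UNIV - {j}. queue_weight k (m' k))" for m'
    unfolding weight_eq by (rule prod.remove) auto
  moreover have "(\<Prod>k\<in>UNIV - {j}. queue_weight k (add_customer m j i k))
      = (\<Prod>k\<in>UNIV - {j}. queue_weight k (m k))"
    by (rule prod.cong) (auto simp: add_customer_def)
  ultimately show ?thesis
    using queue_weight_Suc[OF assms, of "m j"]
    by (simp add: add_customer_def queue_length_def mult_ac)
qed

lemma queue_length_add_customer:
  assumes "R j i"
  shows "queue_length (add_customer m j i) j = Suc (queue_length m j)"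
proof -
  have "add_customer m j i j k = m j k + (if k = i then 1 else 0)" for k
    by (simp add: add_customer_def)
  then show ?thesis
    using assms by (simp add: queue_length_def sum.distrib)
qed

lemma sum_states_shift:
  assumes "R j i"
  shows "(\<Sum>m\<in>states R (N(i := Suc (N i))).
        weight R mu m * (m j i / queue_length m j) * g (remove_customer m j i))
    = (\<Sum>m\<in>states R N. weight R mu m * g m) / mu j i"
    (is "(\<Sum>m\<in>?S. ?f m) = _")
proof -
  have "(\<Sum>m\<in>?S. ?f m) = (\<Sum>m\<in>{m\<in>?S. m j i \<noteq> 0}. ?f m)"
    by (rule sum.mono_neutral_right) (auto simp: finite_states_card)
  also have "\<dots> = (\<Sum>m\<in>states R N. weight R mu m * g m / mu j i)"
  proof (rule sum.reindex_bij_witness[where j = "\<lambda>m. remove_customer m j i" and i = "\<lambda>m. add_customer m j i"])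
    fix m assume m: "m \<in> {m\<in>?S. m j i \<noteq> 0}"
    let ?m = "remove_customer m j i"
    show "?m \<in> states R N"
      using m add_customer_in_states_iff[of R j i ?m N] assms by simp
    have eq: "m = add_customer ?m j i"
      using m by simp
    have l: "queue_length m j = Suc (queue_length ?m j)"
      using queue_length_add_customer[OF assms, of ?m] eq by simp
    have "m j i = Suc (?m j i)"
      using m by (simp add: remove_customer_def)
    then have "weight R mu m * mu j i * m j i = weight R mu ?m * queue_length m j"
      using weight_add_customer[OF assms, of ?m] eq l by metis
    then have "weight R mu ?m / mu j i = weight R mu m * (m j i / queue_length m j)"
      using mu_pos[OF assms] l by (simp add: field_simps)
    then show "weight R mu ?m * g ?m / mu j i = ?f m"
      by (metis times_divide_eq_left)
  next
    fix m assume "m \<in> states R N"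
    then show "add_customer m j i \<in> {m\<in>?S. m j i \<noteq> 0}"
      using add_customer_in_states_iff[of R j i m N] assms by (simp add: add_customer_def)
  qed auto
  finally show ?thesis
    by (simp add: sum_divide_distrib)
qed

definition restricted_const :: "'j set \<Rightarrow> ('i \<Rightarrow> nat) \<Rightarrow> real" where
  "restricted_const A N = (\<Sum>m\<in>states R N. weight R mu m * of_bool (\<forall>j\<in>A. \<forall>i. m j i = 0))"

lemma restricted_const_empty [simp]: "restricted_const {} N = B N"
  by (simp add: restricted_const_def normconst_def)

lemma restricted_const_nonneg: "0 \<le> restricted_const A N"
  unfolding restricted_const_def
  by (intro sum_nonneg mult_nonneg_nonneg) (auto simp: weight_pos less_imp_le)

lemma restricted_const_rec:
  assumes "j \<notin> A"
  shows "restricted_const (insert j A) N = restricted_const A N -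
    (\<Sum>i\<in>{i. R j i}. (if N i = 0 then 0 else restricted_const A (N(i := N i - 1))) / mu j i)"
proof -
  define I where "I m = (of_bool (\<forall>j\<in>A. \<forall>i. m j i = 0) :: real)" for m :: "'j \<Rightarrow> 'i \<Rightarrow> nat"
  have step: "(\<Sum>m\<in>states R N. weight R mu m * (m j i / queue_length m j) * I m)
      = (if N i = 0 then 0 else restricted_const A (N(i := N i - 1))) / mu j i" if i: "R j i" for i
  proof (cases "N i = 0")
    case True
    then have "m j i = 0" if "m \<in> states R N" for m
      using states_le[OF that, of j i] by simp
    then have "(\<Sum>m\<in>states R N. weight R mu m * (m j i / queue_length m j) * I m) = 0"
      by (intro sum.neutral) simp
    with True show ?thesis by simp
  next
    case False
    let ?N = "N(i := N i - 1)"
    have N: "?N(i := Suc (?N i)) = N"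
      using False by auto
    have "remove_customer m j i k = m k" if "k \<in> A" for m k
      using assms that by (auto simp: remove_customer_def)
    then have I: "I (remove_customer m j i) = I m" for m
      by (simp add: I_def)
    show ?thesis
      using sum_states_shift[OF i, where N = ?N and g = I] False
      unfolding N I by (simp add: restricted_const_def I_def)
  qed
  have split: "weight R mu m * I m = weight R mu m * of_bool (\<forall>j\<in>insert j A. \<forall>i. m j i = 0)
      + (\<Sum>i\<in>{i. R j i}. weight R mu m * (m j i / queue_length m j) * I m)"
    if m: "m \<in> states R N" for m
  proof -
    have sum: "(\<Sum>i\<in>{i. R j i}. weight R mu m * (m j i / queue_length m j) * I m)
      = weight R mu m * I m * ((\<Sum>i\<in>{i. R j i}. real (m j i)) / queue_length m j)"
      by (simp add: sum_distrib_left sum_distrib_right sum_divide_distrib mult_ac)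
    have z: "queue_length m j = 0 \<longleftrightarrow> (\<forall>i. m j i = 0)"
      using m by (auto simp: queue_length_def states_def)
    show ?thesis
    proof (cases "queue_length m j = 0")
      case True
      then show ?thesis
        using z by (simp add: I_def)
    next
      case False
      then have "(\<Sum>i\<in>{i. R j i}. real (m j i)) / queue_length m j = 1"
        by (simp add: queue_length_def flip: of_nat_sum)
      then show ?thesis
        using z False unfolding sum by auto
    qed
  qed
  have "restricted_const A N = (\<Sum>m\<in>states R N. weight R mu m * I m)"
    by (simp add: restricted_const_def I_def)
  also have "\<dots> = restricted_const (insert j A) N
      + (\<Sum>m\<in>states R N. \<Sum>i\<in>{i. R j i}. weight R mu m * (m j i / queue_length m j) * I m)"
    by (simp only: restricted_const_def split sum.distrib cong: sum.cong)
  also have "(\<Sum>m\<in>states R N. \<Sum>i\<in>{i. R j i}. weight R mu m * (m j i / queue_length m j) * I m)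
      = (\<Sum>i\<in>{i. R j i}. \<Sum>m\<in>states R N. weight R mu m * (m j i / queue_length m j) * I m)"
    by (rule sum.swap)
  also have "\<dots> = (\<Sum>i\<in>{i. R j i}. (if N i = 0 then 0 else restricted_const A (N(i := N i - 1))) / mu j i)"
    by (rule sum.cong) (simp_all only: step mem_Collect_eq)
  finally show ?thesis by simp
qed

lemma states_nonempty: "states R N \<noteq> {}"
proof -
  define f where "f i = (SOME j. R j i)" for i
  have f: "R (f i) i" for i
    unfolding f_def by (rule someI_ex[OF route_nonempty])
  have "(\<lambda>j i. if j = f i then N i else 0) \<in> states R N"
    using f by (auto simp: states_def)
  then show ?thesis by blast
qed

lemma B_pos: "0 < B N"
  unfolding normconst_def
  by (rule sum_pos) (auto simp: finite_states_card states_nonempty weight_pos)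

definition throughput :: "'i \<Rightarrow> ('i \<Rightarrow> nat) \<Rightarrow> real" where
  "throughput i N = (if N i = 0 then 0 else B (N(i := N i - 1)) / B N)"

lemma throughput_nonneg: "0 \<le> throughput i N"
  using B_pos by (simp add: throughput_def less_imp_le)

lemma throughput_pos: "N i \<noteq> 0 \<Longrightarrow> 0 < throughput i N"
  using B_pos by (simp add: throughput_def)

lemma throughput_capacity: "(\<Sum>i\<in>{i. R j i}. throughput i N / mu j i) \<le> 1"
proof -
  have "(\<Sum>i\<in>{i. R j i}. (if N i = 0 then 0 else B (N(i := N i - 1))) / mu j i) \<le> B N"
    using restricted_const_rec[of j "{}" N] restricted_const_nonneg[of "{j}" N]
    unfolding restricted_const_empty by simp
  moreover have "(\<Sum>i\<in>{i. R j i}. throughput i N / mu j i)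
      = (\<Sum>i\<in>{i. R j i}. (if N i = 0 then 0 else B (N(i := N i - 1))) / mu j i) / B N"
    unfolding sum_divide_distrib by (rule sum.cong) (auto simp: throughput_def)
  ultimately show ?thesis
    using B_pos[of N] by (simp add: divide_le_eq)
qed

lemma throughput_feasible: "feasible R mu (\<lambda>i. throughput i N)"
  by (simp add: feasible_def throughput_nonneg throughput_capacity)

lemma throughput_le:
  assumes "R j i"
  shows "throughput i N \<le> mu j i"
proof -
  have "throughput i N / mu j i \<le> (\<Sum>i\<in>{i. R j i}. throughput i N / mu j i)"
    by (rule member_le_sum) (use assms in \<open>auto simp: throughput_nonneg mu_pos less_imp_le\<close>)
  then have "throughput i N / mu j i \<le> 1"
    using throughput_capacity[of N j] by linarith
  then show ?thesis
    using mu_pos[OF assms] by simp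
qed

lemma sum_decrement:
  fixes N :: "'i \<Rightarrow> nat"
  assumes "N i \<noteq> 0"
  shows "(\<Sum>k\<in>UNIV. N k) = Suc (\<Sum>k\<in>UNIV. (N(i := N i - 1)) k)"
proof -
  have "N k = (N(i := N i - 1)) k + (if k = i then 1 else 0)" for k
    using assms by simp
  then have "(\<Sum>k\<in>UNIV. N k) = (\<Sum>k\<in>UNIV. (N(i := N i - 1)) k + (if k = i then 1 else 0))"
    by (rule sum.cong[OF refl])
  then show ?thesis
    by (simp add: sum.distrib)
qed

lemma ln_B_decrement:
  assumes "N i \<noteq> 0"
  shows "ln (B N) = ln (B (N(i := N i - 1))) - ln (throughput i N)"
  using assms B_pos[of N] B_pos[of "N(i := N i - 1)"] by (simp add: throughput_def ln_div)

lemma ln_B_crude_lower: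
  obtains C where "0 \<le> C" and "\<And>N. - C * real (\<Sum>i\<in>UNIV. N i) \<le> ln (B N)"
proof
  define C where "C = (\<Sum>i\<in>UNIV. \<Sum>j\<in>UNIV. \<bar>ln (mu j i)\<bar>)"
  show C: "0 \<le> C"
    unfolding C_def by (intro sum_nonneg) auto
  show "- C * real (\<Sum>i\<in>UNIV. N i) \<le> ln (B N)" for N
  proof (induction "\<Sum>i\<in>UNIV. N i" arbitrary: N)
    case 0
    then have N: "N = (\<lambda>_. 0)" by auto
    have "states R N = {\<lambda>_ _. 0}"
      unfolding N states_def by (auto simp: fun_eq_iff)
    then have "B N = 1"
      by (simp add: normconst_def weight_def)
    then show ?case by (simp add: N)
  next
    case (Suc t)
    then obtain i where i: "N i \<noteq> 0"
      by (metis nat.distinct(1) sum.neutral)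
    obtain j where j: "R j i"
      using route_nonempty by blast
    have "\<bar>ln (mu j i)\<bar> \<le> (\<Sum>j\<in>UNIV. \<bar>ln (mu j i)\<bar>)"
      by (rule member_le_sum) auto
    also have "\<dots> \<le> C"
      unfolding C_def by (rule member_le_sum[where i = i]) (auto intro: sum_nonneg)
    finally have "ln (mu j i) \<le> C" by linarith
    moreover have "ln (throughput i N) \<le> ln (mu j i)"
      using throughput_le[OF j, of N] throughput_pos[of N i] i ln_le_cancel_iff[of "throughput i N" "mu j i"]
      by linarith
    moreover have t: "t = (\<Sum>k\<in>UNIV. (N(i := N i - 1)) k)"
      using Suc.hyps(2) sum_decrement[of N i] i by simp
    have "- C * real (\<Sum>k\<in>UNIV. (N(i := N i - 1)) k) \<le> ln (B (N(i := N i - 1)))"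
      by (rule Suc.hyps(1)[OF t])
    ultimately show ?case
      unfolding ln_B_decrement[of N i, OF i] Suc.hyps(2)[symmetric] t[symmetric]
      by (simp add: algebra_simps)
  qed
qed

lemma weight_le:
  assumes y: "\<And>j i. R j i \<Longrightarrow> 0 < y j i"
  shows "weight R mu m \<le> (\<Prod>j\<in>UNIV. (\<Sum>i\<in>{i. R j i}. y j i) ^ queue_length m j
    / (\<Prod>i\<in>{i. R j i}. (mu j i * y j i) ^ m j i))"
  unfolding weight_eq
proof (rule prod_mono, intro conjI)
  fix j
  show "0 \<le> queue_weight j (m j)"
    by (simp add: queue_weight_pos less_imp_le)
  let ?I = "{i. R j i}"
  have P: "0 < (\<Prod>i\<in>?I. (mu j i * y j i) ^ m j i)"
    by (intro prod_pos) (auto simp: mu_pos y)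
  have "(\<Prod>i\<in>?I. (1 / mu j i) ^ m j i) * (\<Prod>i\<in>?I. (mu j i * y j i) ^ m j i) = (\<Prod>i\<in>?I. y j i ^ m j i)"
    unfolding prod.distrib[symmetric] power_mult_distrib[symmetric]
    by (rule prod.cong) (use mu_pos in \<open>force simp: field_simps\<close>)+
  then have "queue_weight j (m j) * (\<Prod>i\<in>?I. (mu j i * y j i) ^ m j i)
     = fact (\<Sum>i\<in>?I. m j i) / (\<Prod>i\<in>?I. fact (m j i)) * (\<Prod>i\<in>?I. y j i ^ m j i)"
    by (simp add: queue_weight_def)
  also have "\<dots> \<le> (\<Sum>i\<in>?I. y j i) ^ queue_length m j"
    unfolding queue_length_def by (rule multinomial_term_le) (auto simp: y less_imp_le)
  finally show "queue_weight j (m j) \<le> (\<Sum>i\<in>?I. y j i) ^ queue_length m j / (\<Prod>i\<in>?I. (mu j i * y j i) ^ m j i)"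
    using P by (simp add: field_simps)
qed

end

subsection \<open>Lower bound on the normalizing constant\<close>

locale optimal_network = queueing_network R mu
  for R :: "'j::finite \<Rightarrow> 'i::finite \<Rightarrow> bool" and mu :: "'j \<Rightarrow> 'i \<Rightarrow> real" +
  fixes n Lam :: "'i \<Rightarrow> real"
  assumes n_nonneg: "0 \<le> n i"
    and opt: "is_optimizer R mu n Lam"
    and opt_unique: "is_optimizer R mu n L \<Longrightarrow> L = Lam"
begin

definition load :: "'j \<Rightarrow> real" where
  "load j = (\<Sum>i\<in>{i. R j i}. Lam i / mu j i)"

lemma Lam_nonneg: "0 \<le> Lam i"
  using opt by (simp add: is_optimizer_def feasible_def)

lemma load_le_1: "load j \<le> 1"
  using opt by (simp add: is_optimizer_def feasible_def load_def)

lemma Lam_pos: "0 < n i \<Longrightarrow> 0 < Lam i"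
  using opt by (simp add: is_optimizer_def)

lemma n_zero_iff: "n i = 0 \<longleftrightarrow> \<not> 0 < n i"
  using n_nonneg[of i] by auto

lemma optimal:
  assumes "feasible R mu L" and "\<And>i. 0 < n i \<Longrightarrow> 0 < L i"
  shows "(\<Sum>i\<in>UNIV. n i * ln (L i)) \<le> (\<Sum>i\<in>UNIV. n i * ln (Lam i))"
  using opt assms unfolding is_optimizer_def by blast

lemma zero_route_rigid:
  assumes "n i = 0" and "feasible R mu (Lam(i := x))"
  shows "x = Lam i"
proof -
  have "(\<Sum>k\<in>UNIV. n k * ln ((Lam(i := x)) k)) = (\<Sum>k\<in>UNIV. n k * ln (Lam k))"
    by (rule sum.cong) (auto simp: assms(1))
  then have "is_optimizer R mu n (Lam(i := x))"
    using opt assms unfolding is_optimizer_def by auto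
  then show ?thesis
    using opt_unique by (metis fun_upd_same)
qed

lemma load_update:
  assumes "R j i"
  shows "(\<Sum>k\<in>{k. R j k}. (Lam(i := x)) k / mu j k) = load j + (x - Lam i) / mu j i"
proof -
  have "(Lam(i := x)) k / mu j k = Lam k / mu j k + (if k = i then (x - Lam i) / mu j i else 0)" for k
    by (simp add: diff_divide_distrib)
  then show ?thesis
    using assms by (simp add: load_def sum.distrib)
qed

lemma load_update_other:
  assumes "\<not> R j i"
  shows "(\<Sum>k\<in>{k. R j k}. (Lam(i := x)) k / mu j k) = load j"
  unfolding load_def by (rule sum.cong) (use assms in auto)

lemma Lam_zero:
  assumes "n i = 0"
  shows "Lam i = 0"
proof -
  have "(\<Sum>k\<in>{k. R j k}. (Lam(i := 0)) k / mu j k) \<le> 1" for j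
  proof (cases "R j i")
    case True
    then have "(0 - Lam i) / mu j i \<le> 0"
      using Lam_nonneg[of i] mu_pos[OF True] by (simp add: field_simps)
    then show ?thesis
      unfolding load_update[OF True] using load_le_1[of j] by linarith
  next
    case False
    show ?thesis
      unfolding load_update_other[OF False] by (rule load_le_1)
  qed
  then have "feasible R mu (Lam(i := 0))"
    unfolding feasible_def using Lam_nonneg by simp
  then show ?thesis
    using zero_route_rigid[OF assms] by simp
qed

lemma tight_queue:
  assumes "n i = 0"
  shows "\<exists>j. R j i \<and> load j = 1"
proof (rule ccontr)
  assume "\<not> ?thesis"
  then have slack: "load j < 1" if "R j i" for j
    using load_le_1[of j] that by force
  define d where "d = Min ((\<lambda>j. (1 - load j) * mu j i) ` {j. R j i})"
  have ne: "{j. R j i} \<noteq> {}"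
    using route_nonempty by blast
  then have d: "0 < d"
    unfolding d_def using slack mu_pos by (subst Min_gr_iff) auto
  have "(\<Sum>k\<in>{k. R j k}. (Lam(i := Lam i + d)) k / mu j k) \<le> 1" for j
  proof (cases "R j i")
    case True
    have "d \<le> (1 - load j) * mu j i"
      unfolding d_def using True by (intro Min_le) auto
    then have "d / mu j i \<le> 1 - load j"
      using mu_pos[OF True] by (simp add: field_simps)
    then show ?thesis
      unfolding load_update[OF True] by simp
  next
    case False
    show ?thesis
      unfolding load_update_other[OF False] by (rule load_le_1)
  qed
  then have "feasible R mu (Lam(i := Lam i + d))"
    unfolding feasible_def using Lam_nonneg d by (simp add: add_nonneg_pos less_imp_le)
  then show False
    using zero_route_rigid[OF assms] d by fastforce
qed

definition T :: real where "T = (\<Sum>i\<in>UNIV. n i)"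

definition dir :: "'i \<Rightarrow> real" where "dir i = n i / T"

lemma T_pos: "0 < T"
proof (rule ccontr)
  assume "\<not> 0 < T"
  then have "T = 0"
    unfolding T_def using n_nonneg by (metis order_less_le sum_nonneg)
  then have z: "n i = 0" for i
    using n_nonneg sum_nonneg_eq_0_iff[of UNIV n] by (simp add: T_def)
  obtain j where "load j = 1"
    using tight_queue[OF z] by blast
  then show False
    using Lam_zero[OF z] by (simp add: load_def)
qed

lemma dir_nonneg: "0 \<le> dir i"
  using n_nonneg[of i] T_pos by (simp add: dir_def)

lemma dir_pos_iff: "0 < dir i \<longleftrightarrow> 0 < n i"
  using T_pos by (simp add: dir_def zero_less_divide_iff)

lemma sum_dir: "(\<Sum>i\<in>UNIV. dir i) = 1"
  using T_pos by (simp add: dir_def T_def flip: sum_divide_distrib)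

text \<open>Since \<open>ln 0 = 0\<close> and \<open>Lam i = 0\<close> whenever \<open>n i = 0\<close>, such routes do not contribute to the sum.\<close>

definition excess :: "('i \<Rightarrow> nat) \<Rightarrow> real" where
  "excess N = ln (B N) + (\<Sum>i\<in>UNIV. N i * ln (Lam i))"

definition spread :: "('i \<Rightarrow> nat) \<Rightarrow> real" where
  "spread N = (\<Sum>i\<in>UNIV. (N i - (\<Sum>k\<in>UNIV. real (N k)) * dir i)\<^sup>2) + (\<Sum>k\<in>UNIV. real (N k))"

lemma decrement_real:
  fixes N :: "'i \<Rightarrow> nat"
  assumes "N i \<noteq> 0"
  shows "real ((N(i := N i - 1)) k) = real (N k) - of_bool (k = i)"
  using assms by (simp add: of_nat_diff)

lemma sum_of_bool_eq:
  fixes f :: "'i \<Rightarrow> real"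
  shows "(\<Sum>k\<in>UNIV. of_bool (k = i) * f k) = f i"
proof -
  have "of_bool (k = i) * f k = (if k = i then f k else 0)" for k by simp
  then show ?thesis by simp
qed

lemma excess_superharmonic:
  assumes N: "\<And>i. 0 < n i \<Longrightarrow> N i \<noteq> 0"
  shows "(\<Sum>i\<in>UNIV. dir i * excess (N(i := N i - 1))) \<le> excess N"
proof -
  have step: "dir i * excess (N(i := N i - 1)) = dir i * excess N + (n i * ln (throughput i N) - n i * ln (Lam i)) / T" for i
  proof (cases "0 < n i")
    case True
    have "(\<Sum>k\<in>UNIV. real ((N(i := N i - 1)) k) * ln (Lam k))
        = (\<Sum>k\<in>UNIV. N k * ln (Lam k) - of_bool (k = i) * ln (Lam k))"
      unfolding decrement_real[of N i, OF N[OF True]] by (simp add: algebra_simps)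
    also have "\<dots> = (\<Sum>k\<in>UNIV. N k * ln (Lam k)) - ln (Lam i)"
      unfolding sum_subtractf sum_of_bool_eq ..
    finally have eq: "excess (N(i := N i - 1)) = excess N + ln (throughput i N) - ln (Lam i)"
      using ln_B_decrement[of N i, OF N[OF True]] by (simp add: excess_def)
    show ?thesis
      unfolding eq using T_pos by (simp add: dir_def field_simps)
  next
    case False
    then show ?thesis
      by (simp add: dir_def flip: n_zero_iff)
  qed
  have "(\<Sum>i\<in>UNIV. dir i * excess (N(i := N i - 1)))
      = excess N + ((\<Sum>i\<in>UNIV. n i * ln (throughput i N)) - (\<Sum>i\<in>UNIV. n i * ln (Lam i))) / T"
    unfolding step sum.distrib
    by (simp add: sum_dir flip: sum_distrib_right sum_divide_distrib sum_subtractf)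
  moreover have "(\<Sum>i\<in>UNIV. n i * ln (throughput i N)) \<le> (\<Sum>i\<in>UNIV. n i * ln (Lam i))"
    by (rule optimal[OF throughput_feasible throughput_pos[OF N]])
  ultimately show ?thesis
    using T_pos by (simp add: divide_le_0_iff)
qed

lemma spread_superharmonic:
  assumes N: "\<And>i. 0 < n i \<Longrightarrow> N i \<noteq> 0"
  shows "(\<Sum>i\<in>UNIV. dir i * spread (N(i := N i - 1))) \<le> spread N"
proof -
  define t where "t = (\<Sum>k\<in>UNIV. real (N k))"
  define D where "D k = N k - t * dir k" for k
  have step: "dir i * spread (N(i := N i - 1))
      = dir i * ((\<Sum>k\<in>UNIV. (D k + dir k)\<^sup>2) + t) - 2 * (dir i * (D i + dir i))" for i
  proof (cases "0 < n i")
    case True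
    note dec = decrement_real[of N i, OF N[OF True]]
    have t: "(\<Sum>k\<in>UNIV. real ((N(i := N i - 1)) k)) = t - 1"
      unfolding dec sum_subtractf t_def using sum_of_bool_eq[of i "\<lambda>_. 1"] by simp
    have "(\<Sum>k\<in>UNIV. (real ((N(i := N i - 1)) k) - (t - 1) * dir k)\<^sup>2)
        = (\<Sum>k\<in>UNIV. (D k + dir k)\<^sup>2 + of_bool (k = i) * (1 - 2 * (D k + dir k)))"
      unfolding dec D_def by (rule sum.cong) (auto simp: power2_eq_square algebra_simps)
    also have "\<dots> = (\<Sum>k\<in>UNIV. (D k + dir k)\<^sup>2) + (1 - 2 * (D i + dir i))"
      unfolding sum.distrib sum_of_bool_eq ..
    finally have eq: "spread (N(i := N i - 1)) = (\<Sum>k\<in>UNIV. (D k + dir k)\<^sup>2) + t - 2 * (D i + dir i)"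
      unfolding spread_def t by simp
    show ?thesis
      unfolding eq by (simp add: algebra_simps)
  next
    case False
    then show ?thesis
      by (simp add: dir_def flip: n_zero_iff)
  qed
  have "(\<Sum>i\<in>UNIV. dir i * spread (N(i := N i - 1)))
      = (\<Sum>k\<in>UNIV. (D k + dir k)\<^sup>2) + t - 2 * (\<Sum>i\<in>UNIV. dir i * (D i + dir i))"
    unfolding step sum_subtractf
    by (simp add: sum_dir flip: sum_distrib_right sum_distrib_left)
  also have "\<dots> = (\<Sum>k\<in>UNIV. (D k)\<^sup>2 - (dir k)\<^sup>2) + t"
    by (simp add: sum_distrib_left power2_eq_square algebra_simps sum.distrib sum_subtractf)
  also have "\<dots> \<le> (\<Sum>k\<in>UNIV. (D k)\<^sup>2) + t"
    by (simp add: sum_mono)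
  also have "\<dots> = spread N"
    by (simp add: spread_def D_def t_def)
  finally show ?thesis .
qed

lemma excess_lower_bound:
  obtains A where "0 \<le> A" and "\<And>s N. 0 < s \<Longrightarrow> - A * (spread N / s + s) \<le> excess N"
proof -
  obtain C where C: "0 \<le> C" "\<And>N. - C * real (\<Sum>i\<in>UNIV. N i) \<le> ln (B N)"
    using ln_B_crude_lower by blast
  define C' where "C' = (\<Sum>i\<in>UNIV. \<bar>ln (Lam i)\<bar>)"
  have C': "0 \<le> C'" "\<And>i. \<bar>ln (Lam i)\<bar> \<le> C'"
    unfolding C'_def by (auto intro: sum_nonneg member_le_sum)
  have crude: "- (C + C') * (\<Sum>i\<in>UNIV. real (N i)) \<le> excess N" for N
  proof -
    have "- C' * real (N i) \<le> N i * ln (Lam i)" for i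
    proof -
      have "- C' \<le> ln (Lam i)" using C'(2)[of i] by linarith
      from mult_left_mono[OF this, of "real (N i)"] show ?thesis by (simp add: mult.commute)
    qed
    then have "(\<Sum>i\<in>UNIV. - C' * real (N i)) \<le> (\<Sum>i\<in>UNIV. N i * ln (Lam i))"
      by (rule sum_mono)
    then have "- C' * (\<Sum>i\<in>UNIV. real (N i)) \<le> (\<Sum>i\<in>UNIV. N i * ln (Lam i))"
      by (simp add: sum_distrib_left)
    with C(2)[of N] show ?thesis
      by (simp add: excess_def algebra_simps)
  qed
  define A where "A = (\<Sum>i\<in>UNIV. (C + C') / dir i)"
  have A: "0 \<le> A" "\<And>i. (C + C') / dir i \<le> A"
    unfolding A_def using C(1) C'(1) dir_nonneg by (auto intro!: sum_nonneg member_le_sum)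
  have "- A * (spread N / s + s) \<le> excess N" if s: "0 < s" for s N
  proof (induction "\<Sum>i\<in>UNIV. N i" arbitrary: N rule: less_induct)
    case less
    show ?case
    proof (cases "\<forall>i. 0 < n i \<longrightarrow> N i \<noteq> 0")
      case True
      then have N: "\<And>i. 0 < n i \<Longrightarrow> N i \<noteq> 0" by blast
      have "dir i * (- A * (spread (N(i := N i - 1)) / s + s)) \<le> dir i * excess (N(i := N i - 1))" for i
      proof (cases "0 < n i")
        case True
        have "(\<Sum>k\<in>UNIV. (N(i := N i - 1)) k) < (\<Sum>k\<in>UNIV. N k)"
          using sum_decrement[of N i, OF N[OF True]] by linarith
        then show ?thesis
          by (intro mult_left_mono less dir_nonneg)
      next
        case False
        then show ?thesis
          by (simp add: dir_def flip: n_zero_iff)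
      qed
      then have "(\<Sum>i\<in>UNIV. dir i * (- A * (spread (N(i := N i - 1)) / s + s)))
          \<le> (\<Sum>i\<in>UNIV. dir i * excess (N(i := N i - 1)))"
        by (rule sum_mono)
      also have "\<dots> \<le> excess N"
        by (rule excess_superharmonic[OF N])
      also have "(\<Sum>i\<in>UNIV. dir i * (- A * (spread (N(i := N i - 1)) / s + s)))
          = - A * ((\<Sum>i\<in>UNIV. dir i * spread (N(i := N i - 1))) / s + s * (\<Sum>i\<in>UNIV. dir i))"
        by (simp add: sum_distrib_left sum_distrib_right sum_divide_distrib sum.distrib
            sum_subtractf sum_negf algebra_simps)
      finally have le: "- A * ((\<Sum>i\<in>UNIV. dir i * spread (N(i := N i - 1))) / s + s) \<le> excess N"
        by (simp add: sum_dir)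
      have "(\<Sum>i\<in>UNIV. dir i * spread (N(i := N i - 1))) / s \<le> spread N / s"
        using spread_superharmonic[of N, OF N] s by (intro divide_right_mono) auto
      then have "A * ((\<Sum>i\<in>UNIV. dir i * spread (N(i := N i - 1))) / s + s) \<le> A * (spread N / s + s)"
        using A(1) by (intro mult_left_mono) auto
      with le show ?thesis by simp
    next
      case False
      then obtain i where i: "0 < n i" "N i = 0" by blast
      define t where "t = (\<Sum>k\<in>UNIV. real (N k))"
      have t: "0 \<le> t" unfolding t_def by (intro sum_nonneg) auto
      have "(t * dir i)\<^sup>2 \<le> (\<Sum>k\<in>UNIV. (N k - t * dir k)\<^sup>2)"
        using member_le_sum[of i UNIV "\<lambda>k. (N k - t * dir k)\<^sup>2"] i(2) by simp
      then have sp: "(t * dir i)\<^sup>2 \<le> spread N"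
        using t by (simp add: spread_def t_def)
      have "0 \<le> (t * dir i - s)\<^sup>2" by simp
      then have "2 * (t * dir i) * s \<le> spread N + s * s"
        using sp by (simp add: power2_eq_square algebra_simps)
      then have "2 * (t * dir i) \<le> (spread N + s * s) / s"
        using s by (simp add: pos_le_divide_eq)
      then have "2 * (t * dir i) \<le> spread N / s + s"
        using s by (simp add: add_divide_distrib)
      moreover have "0 \<le> t * dir i" using t dir_nonneg by simp
      ultimately have "t * dir i \<le> spread N / s + s" by linarith
      then have "A * (t * dir i) \<le> A * (spread N / s + s)"
        by (rule mult_left_mono[OF _ A(1)])
      moreover have "(C + C') * t \<le> A * (t * dir i)"
      proof -
        have "C + C' \<le> A * dir i"
          using A(2)[of i] i(1) by (simp add: pos_divide_le_eq dir_pos_iff)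
        from mult_right_mono[OF this t] show ?thesis by (simp add: mult_ac)
      qed
      ultimately show ?thesis
        using crude[of N] unfolding t_def by (simp only: minus_mult_left[symmetric])
    qed
  qed
  with A(1) show ?thesis by (rule that)
qed

subsection \<open>Concentration of the queue compositions\<close>

lemma queue_length_le_real:
  assumes "m \<in> states R N"
  shows "real (queue_length m j) \<le> (\<Sum>i\<in>UNIV. real (N i))"
  using queue_length_le_total[OF assms, of j]
  unfolding queue_length_def of_nat_sum[symmetric] of_nat_le_iff .

lemma excess_weight_bound:
  assumes m: "m \<in> states R N" and R: "R j\<^sub>0 i\<^sub>0" and n: "0 < n i\<^sub>0" and \<tau>: "0 < \<tau>"
  shows "ln (weight R mu m) + (\<Sum>i\<in>UNIV. N i * ln (Lam i))
    \<le> - (\<Sum>i\<in>{i. n i = 0}. real (N i)) * ln \<tau>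
      + \<tau> * (\<Sum>j\<in>UNIV. \<Sum>i\<in>{i. R j i}. 1 / mu j i) * (\<Sum>i\<in>UNIV. real (N i))
      + Lam i\<^sub>0 / mu j\<^sub>0 i\<^sub>0 * queue_length m j\<^sub>0 * (exp \<theta> - 1) - \<theta> * m j\<^sub>0 i\<^sub>0"
proof -
  define L where "L i = (if n i = 0 then \<tau> else Lam i)" for i
  define \<epsilon> where "\<epsilon> j i = (if j = j\<^sub>0 \<and> i = i\<^sub>0 then \<theta> else 0)" for j i
  define y where "y j i = L i / mu j i * exp (\<epsilon> j i)" for j i
  have L: "0 < L i" for i
    using \<tau> Lam_pos n_zero_iff by (simp add: L_def)
  have y: "0 < y j i" if "R j i" for j i
    using L mu_pos[OF that] by (simp add: y_def)
  have muy: "mu j i * y j i = exp (ln (L i) + \<epsilon> j i)" if "R j i" for j i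
    using L[of i] mu_pos[OF that] by (simp add: y_def exp_add)
  have ln_le: "ln x \<le> e" if "0 < x" "x \<le> exp e" for x e :: real
    using that ln_le_cancel_iff[of x "exp e"] by simp
  define t where "t = (\<Sum>i\<in>UNIV. real (N i))"
  have "weight R mu m \<le> (\<Prod>j\<in>UNIV. (\<Sum>i\<in>{i. R j i}. y j i) ^ queue_length m j
      / (\<Prod>i\<in>{i. R j i}. (mu j i * y j i) ^ m j i))"
    by (rule weight_le) (rule y)
  also have "\<dots> \<le> (\<Prod>j\<in>UNIV. exp (queue_length m j * ((\<Sum>i\<in>{i. R j i}. y j i) - 1)
      - (\<Sum>i\<in>{i. R j i}. m j i * (ln (L i) + \<epsilon> j i))))"
  proof (rule prod_mono, intro conjI)
    fix j
    let ?Y = "\<Sum>i\<in>{i. R j i}. y j i"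
    have Y: "0 \<le> ?Y" by (intro sum_nonneg) (simp add: y less_imp_le)
    have P: "(\<Prod>i\<in>{i. R j i}. (mu j i * y j i) ^ m j i) = exp (\<Sum>i\<in>{i. R j i}. m j i * (ln (L i) + \<epsilon> j i))"
      unfolding exp_sum[OF finite] by (rule prod.cong) (auto simp: muy exp_of_nat_mult)
    show "0 \<le> ?Y ^ queue_length m j / (\<Prod>i\<in>{i. R j i}. (mu j i * y j i) ^ m j i)"
      unfolding P using Y by simp
    have "?Y \<le> exp (?Y - 1)"
      using exp_ge_add_one_self[of "?Y - 1"] by simp
    then have "?Y ^ queue_length m j \<le> exp (?Y - 1) ^ queue_length m j"
      using Y by (rule power_mono)
    then show "?Y ^ queue_length m j / (\<Prod>i\<in>{i. R j i}. (mu j i * y j i) ^ m j i)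
      \<le> exp (queue_length m j * (?Y - 1) - (\<Sum>i\<in>{i. R j i}. m j i * (ln (L i) + \<epsilon> j i)))"
      unfolding P exp_diff exp_of_nat_mult by (rule divide_right_mono) simp
  qed
  also have "\<dots> = exp ((\<Sum>j\<in>UNIV. queue_length m j * ((\<Sum>i\<in>{i. R j i}. y j i) - 1))
      - (\<Sum>j\<in>UNIV. \<Sum>i\<in>{i. R j i}. m j i * (ln (L i) + \<epsilon> j i)))"
    unfolding exp_sum[OF finite, symmetric] sum_subtractf ..
  finally have "ln (weight R mu m) \<le> (\<Sum>j\<in>UNIV. queue_length m j * ((\<Sum>i\<in>{i. R j i}. y j i) - 1))
      - (\<Sum>j\<in>UNIV. \<Sum>i\<in>{i. R j i}. m j i * (ln (L i) + \<epsilon> j i))"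
    by (rule ln_le[OF weight_pos])
  moreover have "(\<Sum>j\<in>UNIV. \<Sum>i\<in>{i. R j i}. m j i * (ln (L i) + \<epsilon> j i))
      = (\<Sum>i\<in>UNIV. N i * ln (Lam i)) + (\<Sum>i\<in>{i. n i = 0}. real (N i)) * ln \<tau> + \<theta> * m j\<^sub>0 i\<^sub>0"
  proof -
    have "(\<Sum>j\<in>UNIV. \<Sum>i\<in>{i. R j i}. m j i * (ln (L i) + \<epsilon> j i))
        = (\<Sum>j\<in>UNIV. \<Sum>i\<in>UNIV. m j i * (ln (L i) + \<epsilon> j i))"
      using m by (intro sum.cong refl sum.mono_neutral_left) (auto simp: states_def)
    also have "\<dots> = (\<Sum>j\<in>UNIV. \<Sum>i\<in>UNIV. m j i * ln (L i)) + (\<Sum>j\<in>UNIV. \<Sum>i\<in>UNIV. m j i * \<epsilon> j i)"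
      by (simp add: distrib_left sum.distrib)
    also have "(\<Sum>j\<in>UNIV. \<Sum>i\<in>UNIV. m j i * \<epsilon> j i) = \<theta> * m j\<^sub>0 i\<^sub>0"
    proof -
      have "m j i * \<epsilon> j i = (if j = j\<^sub>0 then if i = i\<^sub>0 then \<theta> * m j\<^sub>0 i\<^sub>0 else 0 else 0)" for j i
        by (simp add: \<epsilon>_def)
      then have "(\<Sum>i\<in>UNIV. m j i * \<epsilon> j i) = (if j = j\<^sub>0 then \<theta> * m j\<^sub>0 i\<^sub>0 else 0)" for j
        by simp
      then show ?thesis by simp
    qed
    also have "(\<Sum>j\<in>UNIV. \<Sum>i\<in>UNIV. m j i * ln (L i)) = (\<Sum>i\<in>UNIV. N i * ln (L i))"
    proof -
      have "(\<Sum>j\<in>UNIV. \<Sum>i\<in>UNIV. m j i * ln (L i)) = (\<Sum>i\<in>UNIV. real (\<Sum>j\<in>UNIV. m j i) * ln (L i))"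
        by (subst sum.swap) (simp add: sum_distrib_right)
      moreover have "(\<Sum>j\<in>UNIV. m j i) = N i" for i
        using m by (simp add: states_def)
      ultimately show ?thesis by (simp only:)
    qed
    also have "\<dots> = (\<Sum>i\<in>UNIV. N i * ln (Lam i) + (if n i = 0 then N i * ln \<tau> else 0))"
      by (rule sum.cong) (auto simp: L_def Lam_zero)
    also have "\<dots> = (\<Sum>i\<in>UNIV. N i * ln (Lam i)) + (\<Sum>i\<in>{i. n i = 0}. real (N i)) * ln \<tau>"
      unfolding sum.distrib by (simp add: sum.If_cases sum_distrib_right)
    finally show ?thesis .
  qed
  moreover have "(\<Sum>j\<in>UNIV. queue_length m j * ((\<Sum>i\<in>{i. R j i}. y j i) - 1))
      \<le> \<tau> * (\<Sum>j\<in>UNIV. \<Sum>i\<in>{i. R j i}. 1 / mu j i) * t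
        + Lam i\<^sub>0 / mu j\<^sub>0 i\<^sub>0 * queue_length m j\<^sub>0 * (exp \<theta> - 1)"
  proof -
    let ?h = "Lam i\<^sub>0 / mu j\<^sub>0 i\<^sub>0 * (exp \<theta> - 1)"
    have Y: "(\<Sum>i\<in>{i. R j i}. y j i) - 1 \<le> \<tau> * (\<Sum>i\<in>{i. R j i}. 1 / mu j i) + (if j = j\<^sub>0 then ?h else 0)" for j
    proof -
      have "(\<Sum>i\<in>{i. R j i}. y j i) \<le> (\<Sum>i\<in>{i. R j i}. Lam i / mu j i + \<tau> * (1 / mu j i)
          + (if i = i\<^sub>0 then if j = j\<^sub>0 then ?h else 0 else 0))"
      proof (rule sum_mono)
        fix i assume "i \<in> {i. R j i}"
        then have mu: "0 < mu j i" by (simp add: mu_pos)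
        have "L i / mu j i \<le> Lam i / mu j i + \<tau> * (1 / mu j i)"
          using mu \<tau> Lam_nonneg[of i] by (simp add: L_def field_simps)
        moreover have "y j i = L i / mu j i + (if i = i\<^sub>0 then if j = j\<^sub>0 then ?h else 0 else 0)"
          using n by (simp add: y_def \<epsilon>_def L_def algebra_simps diff_divide_distrib)
        ultimately show "y j i \<le> Lam i / mu j i + \<tau> * (1 / mu j i)
          + (if i = i\<^sub>0 then if j = j\<^sub>0 then ?h else 0 else 0)" by simp
      qed
      also have "\<dots> = load j + \<tau> * (\<Sum>i\<in>{i. R j i}. 1 / mu j i) + (if j = j\<^sub>0 then ?h else 0)"
        using R by (simp add: sum.distrib load_def sum_distrib_left)
      finally show ?thesis
        using load_le_1[of j] by linarith
    qed
    have "(\<Sum>j\<in>UNIV. queue_length m j * ((\<Sum>i\<in>{i. R j i}. y j i) - 1))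
        \<le> (\<Sum>j\<in>UNIV. t * (\<tau> * (\<Sum>i\<in>{i. R j i}. 1 / mu j i)) + (if j = j\<^sub>0 then queue_length m j\<^sub>0 * ?h else 0))"
    proof (rule sum_mono)
      fix j
      have "real (queue_length m j) \<le> t"
        unfolding t_def by (rule queue_length_le_real[OF m])
      moreover have "0 \<le> \<tau> * (\<Sum>i\<in>{i. R j i}. 1 / mu j i)"
        using \<tau> by (intro mult_nonneg_nonneg sum_nonneg) (auto simp: mu_pos less_imp_le)
      ultimately have "queue_length m j * (\<tau> * (\<Sum>i\<in>{i. R j i}. 1 / mu j i)) \<le> t * (\<tau> * (\<Sum>i\<in>{i. R j i}. 1 / mu j i))"
        by (rule mult_right_mono)
      moreover have "queue_length m j * ((\<Sum>i\<in>{i. R j i}. y j i) - 1)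
          \<le> queue_length m j * (\<tau> * (\<Sum>i\<in>{i. R j i}. 1 / mu j i) + (if j = j\<^sub>0 then ?h else 0))"
        by (rule mult_left_mono[OF Y]) simp
      ultimately show "queue_length m j * ((\<Sum>i\<in>{i. R j i}. y j i) - 1)
          \<le> t * (\<tau> * (\<Sum>i\<in>{i. R j i}. 1 / mu j i)) + (if j = j\<^sub>0 then queue_length m j\<^sub>0 * ?h else 0)"
        by (simp add: distrib_left split: if_splits)
    qed
    also have "\<dots> = \<tau> * (\<Sum>j\<in>UNIV. \<Sum>i\<in>{i. R j i}. 1 / mu j i) * t + queue_length m j\<^sub>0 * ?h"
      by (simp add: sum.distrib sum_distrib_left sum_distrib_right mult_ac)
    finally show ?thesis by (simp add: mult_ac)
  qed
  ultimately show ?thesis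
    unfolding t_def by linarith
qed

definition tracks :: "(nat \<Rightarrow> 'i \<Rightarrow> nat) \<Rightarrow> bool" where
  "tracks N \<longleftrightarrow> (\<exists>K. \<forall>c i. \<bar>real (N c i) - real c * n i\<bar> \<le> K)"

lemma tracks_diff:
  assumes "tracks N"
  shows "tracks (\<lambda>c i. N c i - k i)"
proof -
  obtain K where K: "\<And>c i. \<bar>real (N c i) - real c * n i\<bar> \<le> K"
    using assms tracks_def by auto
  have "\<bar>real (N c i - k i) - real c * n i\<bar> \<le> K + (\<Sum>i\<in>UNIV. real (k i))" for c i
  proof -
    have "real (k i) \<le> (\<Sum>i\<in>UNIV. real (k i))"
      by (rule member_le_sum) auto
    moreover have "real (N c i) - real (k i) \<le> real (N c i - k i)" "real (N c i - k i) \<le> real (N c i)"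
      by linarith+
    ultimately show ?thesis
      using K[of c i] by linarith
  qed
  then show ?thesis
    unfolding tracks_def by blast
qed

lemma tracks_bounds:
  assumes "tracks N"
  obtains K C where "0 \<le> K" and "0 < C"
    and "\<And>c. (\<Sum>i\<in>{i. n i = 0}. real (N c i)) \<le> K"
    and "\<And>c. 1 \<le> c \<Longrightarrow> (\<Sum>i\<in>UNIV. real (N c i)) \<le> C * real c"
    and "\<And>c. 1 \<le> c \<Longrightarrow> spread (N c) \<le> C * real c"
proof -
  obtain K where K: "\<And>c i. \<bar>real (N c i) - real c * n i\<bar> \<le> K"
    using assms tracks_def by auto
  have K0: "0 \<le> K"
    using K[of 0 undefined] by linarith
  define d where "d = real (card (UNIV :: 'i set))"
  define C where "C = d * (K + d * K)\<^sup>2 + T + d * K"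
  have d0: "0 \<le> d" by (simp add: d_def)
  have dK: "0 \<le> d * K" using d0 K0 by simp
  have dK2: "0 \<le> d * (K + d * K)\<^sup>2" using d0 by simp
  have zero: "(\<Sum>i\<in>{i. n i = 0}. real (N c i)) \<le> d * K" for c
  proof -
    have "(\<Sum>i\<in>{i. n i = 0}. real (N c i)) \<le> (\<Sum>i\<in>{i. n i = 0}. K)"
    proof (rule sum_mono)
      show "real (N c i) \<le> K" if "i \<in> {i. n i = 0}" for i
        using K[of c i] that by simp
    qed
    also have "\<dots> \<le> (\<Sum>i\<in>(UNIV :: 'i set). K)"
      by (rule sum_mono2) (use K0 in auto)
    finally show ?thesis by (simp add: d_def)
  qed
  have tot: "\<bar>(\<Sum>i\<in>UNIV. real (N c i)) - real c * T\<bar> \<le> d * K" for c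
  proof -
    have "(\<Sum>i\<in>UNIV. real (N c i)) - real c * T = (\<Sum>i\<in>UNIV. real (N c i) - real c * n i)"
      by (simp add: T_def sum_subtractf sum_distrib_left)
    also have "\<bar>\<dots>\<bar> \<le> (\<Sum>i\<in>UNIV. \<bar>real (N c i) - real c * n i\<bar>)"
      by (rule sum_abs)
    also have "\<dots> \<le> (\<Sum>i\<in>(UNIV :: 'i set). K)"
      by (rule sum_mono) (rule K)
    finally show ?thesis by (simp add: d_def)
  qed
  have tot_le: "(\<Sum>i\<in>UNIV. real (N c i)) \<le> (T + d * K) * real c" if "1 \<le> c" for c
  proof -
    have "d * K \<le> d * K * real c"
      using mult_left_mono[OF _ dK, of 1 "real c"] that by simp
    then show ?thesis
      using tot[of c] by (simp add: algebra_simps abs_le_iff)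
  qed
  have spread_le: "spread (N c) \<le> C * real c" if c: "1 \<le> c" for c
  proof -
    have "(real (N c i) - (\<Sum>k\<in>UNIV. real (N c k)) * dir i)\<^sup>2 \<le> (K + d * K)\<^sup>2" for i
    proof (rule power2_le_iff_abs_le[THEN iffD2])
      show "0 \<le> K + d * K" using K0 dK by simp
      let ?t = "(\<Sum>k\<in>UNIV. real (N c k)) - real c * T"
      have "dir i \<le> (\<Sum>i\<in>UNIV. dir i)"
        by (rule member_le_sum) (auto simp: dir_nonneg)
      then have "dir i \<le> 1" by (simp add: sum_dir)
      have "\<bar>?t * dir i\<bar> = \<bar>?t\<bar> * dir i"
        using dir_nonneg[of i] by (simp add: abs_mult)
      also have "\<dots> \<le> \<bar>?t\<bar> * 1"
        by (rule mult_left_mono[OF \<open>dir i \<le> 1\<close>]) simp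
      finally have "\<bar>?t * dir i\<bar> \<le> d * K" using tot[of c] by simp
      moreover have "real (N c i) - (\<Sum>k\<in>UNIV. real (N c k)) * dir i = (real (N c i) - real c * n i) - ?t * dir i"
        using T_pos by (simp add: dir_def field_simps)
      ultimately show "\<bar>real (N c i) - (\<Sum>k\<in>UNIV. real (N c k)) * dir i\<bar> \<le> K + d * K"
        using K[of c i] by linarith
    qed
    then have "(\<Sum>i\<in>UNIV. (real (N c i) - (\<Sum>k\<in>UNIV. real (N c k)) * dir i)\<^sup>2) \<le> (\<Sum>i\<in>(UNIV :: 'i set). (K + d * K)\<^sup>2)"
      by (rule sum_mono)
    then have "(\<Sum>i\<in>UNIV. (real (N c i) - (\<Sum>k\<in>UNIV. real (N c k)) * dir i)\<^sup>2) \<le> d * (K + d * K)\<^sup>2"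
      by (simp add: d_def)
    moreover have "d * (K + d * K)\<^sup>2 \<le> d * (K + d * K)\<^sup>2 * real c"
      using mult_left_mono[OF _ dK2, of 1 "real c"] c by simp
    ultimately show ?thesis
      using tot_le[OF c] unfolding spread_def C_def distrib_right by linarith
  qed
  have "(T + d * K) * real c \<le> C * real c" for c
    using dK2 by (intro mult_right_mono) (auto simp: C_def)
  then have tot_C: "(\<Sum>i\<in>UNIV. real (N c i)) \<le> C * real c" if "1 \<le> c" for c
    using tot_le[OF that] order_trans by blast
  have "0 < C"
    using T_pos dK dK2 by (simp add: C_def)
  with dK zero tot_C spread_le show ?thesis
    using that by blast
qed

lemma ratio_le_1:
  assumes "R j i"
  shows "Lam i / mu j i \<le> 1"
proof -
  have "Lam i / mu j i \<le> load j"
    unfolding load_def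
    by (rule member_le_sum) (use assms in \<open>auto simp: Lam_nonneg mu_pos less_imp_le\<close>)
  then show ?thesis
    using load_le_1[of j] by linarith
qed

definition dev :: "('j \<Rightarrow> 'i \<Rightarrow> nat) \<Rightarrow> 'j \<Rightarrow> 'i \<Rightarrow> real" where
  "dev m j i = m j i - Lam i / mu j i * queue_length m j"

lemma deviation_rare:
  assumes N: "tracks N" and R: "R j i" and n: "0 < n i" and \<epsilon>: "0 < \<epsilon>"
  shows "\<exists>\<eta>>0. \<exists>M. \<forall>c\<ge>1. \<forall>m\<in>states R (N c). \<epsilon> * real c < \<bar>dev m j i\<bar>
    \<longrightarrow> weight R mu m \<le> exp (M - \<eta> * real c) * B (N c)"
proof -
  obtain K C where KC: "0 \<le> K" "0 < C"
      "\<And>c. (\<Sum>i\<in>{i. n i = 0}. real (N c i)) \<le> K"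
      "\<And>c. 1 \<le> c \<Longrightarrow> (\<Sum>i\<in>UNIV. real (N c i)) \<le> C * real c"
      "\<And>c. 1 \<le> c \<Longrightarrow> spread (N c) \<le> C * real c"
    using tracks_bounds[OF N] by blast
  obtain A where A: "0 \<le> A" "\<And>s N. 0 < s \<Longrightarrow> - A * (spread N / s + s) \<le> excess N"
    using excess_lower_bound by blast
  define S where "S = (\<Sum>j\<in>UNIV. \<Sum>i\<in>{i. R j i}. 1 / mu j i)"
  have S: "0 \<le> S"
    unfolding S_def by (intro sum_nonneg) (auto simp: mu_pos less_imp_le)
  define p where "p = Lam i / mu j i"
  have p: "0 \<le> p" "p \<le> 1"
    using ratio_le_1[OF R] Lam_nonneg[of i] mu_pos[OF R] by (auto simp: p_def)
  define \<delta> where "\<delta> = min 1 (\<epsilon> / (2 * C))"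
  have \<delta>: "0 < \<delta>" "\<delta> \<le> 1" "\<delta> * C \<le> \<epsilon> / 2"
  proof -
    show "0 < \<delta>" "\<delta> \<le> 1" using \<epsilon> KC(2) by (auto simp: \<delta>_def)
    have "\<delta> \<le> \<epsilon> / (2 * C)" by (simp add: \<delta>_def)
    then show "\<delta> * C \<le> \<epsilon> / 2" using KC(2) by (simp add: field_simps)
  qed
  define \<tau> where "\<tau> = \<delta> * \<epsilon> / (8 * (S * C + 1))"
  define \<sigma> where "\<sigma> = \<delta> * \<epsilon> / (8 * (A + 1))"
  have SC: "0 \<le> S * C" using S KC(2) by simp
  have \<delta>\<epsilon>: "0 < \<delta> * \<epsilon>" using \<delta> \<epsilon> by simp
  have \<tau>: "0 < \<tau>" "\<tau> * (S * C) \<le> \<delta> * \<epsilon> / 8"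
  proof -
    show "0 < \<tau>" unfolding \<tau>_def using \<delta>\<epsilon> SC by simp
    then have "\<tau> * (S * C) \<le> \<tau> * (S * C + 1)" by (simp add: algebra_simps)
    also have "\<dots> = \<delta> * \<epsilon> / 8" unfolding \<tau>_def using SC by (simp add: field_simps)
    finally show "\<tau> * (S * C) \<le> \<delta> * \<epsilon> / 8" .
  qed
  have \<sigma>: "0 < \<sigma>" "A * \<sigma> \<le> \<delta> * \<epsilon> / 8"
  proof -
    show "0 < \<sigma>" unfolding \<sigma>_def using \<delta>\<epsilon> A(1) by simp
    then have "A * \<sigma> \<le> (A + 1) * \<sigma>" by (simp add: algebra_simps)
    also have "\<dots> = \<delta> * \<epsilon> / 8" unfolding \<sigma>_def using A(1) by (simp add: field_simps)
    finally show "A * \<sigma> \<le> \<delta> * \<epsilon> / 8" .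
  qed
  define M where "M = K * \<bar>ln \<tau>\<bar> + A * C / \<sigma>"
  show ?thesis
  proof (intro exI conjI allI ballI impI)
    show "0 < \<delta> * \<epsilon> / 4" using \<delta>\<epsilon> by simp
    fix c :: nat and m
    assume c: "1 \<le> c" and m: "m \<in> states R (N c)" and bad: "\<epsilon> * real c < \<bar>dev m j i\<bar>"
    define q where "q = real (queue_length m j)"
    define t where "t = (\<Sum>i\<in>UNIV. real (N c i))"
    have t: "t \<le> C * real c" using KC(4)[OF c] by (simp add: t_def)
    have q: "0 \<le> q" "q \<le> C * real c"
      using queue_length_le_real[OF m, of j] t by (auto simp: q_def t_def)
    define \<theta> where "\<theta> = (if 0 < dev m j i then \<delta> else - \<delta>)"
    have \<theta>: "\<theta> * dev m j i = \<delta> * \<bar>dev m j i\<bar>" "\<theta>\<^sup>2 = \<delta>\<^sup>2" "\<bar>\<theta>\<bar> \<le> 1"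
      using \<delta> by (auto simp: \<theta>_def)
    have "exp \<theta> - 1 \<le> \<theta> + \<delta>\<^sup>2"
      using exp_le_quadratic[OF \<theta>(3)] \<theta>(2) by simp
    then have "p * q * (exp \<theta> - 1) \<le> p * q * (\<theta> + \<delta>\<^sup>2)"
      using p q by (intro mult_left_mono) auto
    moreover have "p * q * \<delta>\<^sup>2 \<le> \<delta> * \<epsilon> / 2 * real c"
    proof -
      have "p * q * \<delta>\<^sup>2 \<le> 1 * (C * real c) * \<delta>\<^sup>2"
        using p q by (intro mult_right_mono mult_mono) auto
      also have "\<dots> = \<delta> * (\<delta> * C) * real c"
        by (simp add: power2_eq_square)
      also have "\<dots> \<le> \<delta> * (\<epsilon> / 2) * real c"
        using \<delta> by (intro mult_right_mono mult_left_mono) auto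
      finally show ?thesis by simp
    qed
    moreover have "\<theta> * m j i - p * q * \<theta> = \<delta> * \<bar>dev m j i\<bar>"
      using \<theta>(1) by (simp add: dev_def p_def q_def algebra_simps)
    moreover have "\<delta> * (\<epsilon> * real c) \<le> \<delta> * \<bar>dev m j i\<bar>"
      using bad \<delta>(1) by (intro mult_left_mono) auto
    ultimately have tilt: "p * q * (exp \<theta> - 1) - \<theta> * m j i \<le> - (\<delta> * \<epsilon> / 2) * real c"
      by (simp add: algebra_simps)
    have "\<tau> * S * t \<le> \<tau> * S * (C * real c)"
      using t \<tau>(1) S by (intro mult_left_mono) auto
    also have "\<dots> = \<tau> * (S * C) * real c" by simp
    also have "\<dots> \<le> \<delta> * \<epsilon> / 8 * real c"
      by (rule mult_right_mono[OF \<tau>(2)]) simp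
    finally have tau: "\<tau> * S * t \<le> \<delta> * \<epsilon> / 8 * real c" .
    have zero: "- (\<Sum>i\<in>{i. n i = 0}. real (N c i)) * ln \<tau> \<le> K * \<bar>ln \<tau>\<bar>"
    proof -
      have "- (\<Sum>i\<in>{i. n i = 0}. real (N c i)) * ln \<tau> \<le> (\<Sum>i\<in>{i. n i = 0}. real (N c i)) * \<bar>ln \<tau>\<bar>"
        using mult_left_mono[of "- ln \<tau>" "\<bar>ln \<tau>\<bar>" "\<Sum>i\<in>{i. n i = 0}. real (N c i)"]
        by (simp add: sum_nonneg)
      also have "\<dots> \<le> K * \<bar>ln \<tau>\<bar>"
        by (rule mult_right_mono[OF KC(3)]) simp
      finally show ?thesis .
    qed
    have low: "- A * C / \<sigma> - \<delta> * \<epsilon> / 8 * real c \<le> excess (N c)"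
    proof -
      have s: "0 < \<sigma> * real c" using \<sigma>(1) c by simp
      have "spread (N c) / (\<sigma> * real c) \<le> C * real c / (\<sigma> * real c)"
        using KC(5)[OF c] s by (intro divide_right_mono) auto
      also have "\<dots> = C / \<sigma>" using c by simp
      finally have "A * (spread (N c) / (\<sigma> * real c) + \<sigma> * real c) \<le> A * (C / \<sigma> + \<sigma> * real c)"
        using A(1) by (intro mult_left_mono) auto
      also have "\<dots> = A * C / \<sigma> + A * \<sigma> * real c" by (simp add: algebra_simps)
      also have "\<dots> \<le> A * C / \<sigma> + \<delta> * \<epsilon> / 8 * real c"
        using mult_right_mono[OF \<sigma>(2), of "real c"] by simp
      finally show ?thesis
        using A(2)[OF s, of "N c"] by simp
    qed
    have "ln (weight R mu m) + (\<Sum>i\<in>UNIV. N c i * ln (Lam i))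
        \<le> - (\<Sum>i\<in>{i. n i = 0}. real (N c i)) * ln \<tau> + \<tau> * S * t + p * q * (exp \<theta> - 1) - \<theta> * m j i"
      using excess_weight_bound[OF m R n \<tau>(1), of \<theta>] unfolding S_def t_def p_def q_def .
    with zero tau tilt low have "ln (weight R mu m) \<le> ln (B (N c)) + (M - \<delta> * \<epsilon> / 4 * real c)"
      unfolding M_def excess_def by (simp add: algebra_simps)
    then have "exp (ln (weight R mu m)) \<le> exp (ln (B (N c)) + (M - \<delta> * \<epsilon> / 4 * real c))"
      by simp
    then show "weight R mu m \<le> exp (M - \<delta> * \<epsilon> / 4 * real c) * B (N c)"
      using weight_pos[of m] B_pos[of "N c"] by (simp add: exp_add mult.commute)
  qed
qed

definition mean_dev :: "('i \<Rightarrow> nat) \<Rightarrow> 'j \<Rightarrow> 'i \<Rightarrow> real" where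
  "mean_dev N j i = (\<Sum>m\<in>states R N. weight R mu m * \<bar>dev m j i\<bar>) / B N"

lemma mean_dev_sublinear:
  assumes N: "tracks N" and R: "R j i" and n: "0 < n i"
  shows "(\<lambda>c. mean_dev (N c) j i / real c) \<longlonglongrightarrow> 0"
proof (rule tendstoI)
  fix e :: real assume "0 < e"
  define \<epsilon> where "\<epsilon> = e / 2"
  have \<epsilon>: "0 < \<epsilon>" using \<open>0 < e\<close> by (simp add: \<epsilon>_def)
  obtain \<eta> M where \<eta>: "0 < \<eta>"
    and rare: "\<forall>c\<ge>1. \<forall>m\<in>states R (N c). \<epsilon> * real c < \<bar>dev m j i\<bar>
      \<longrightarrow> weight R mu m \<le> exp (M - \<eta> * real c) * B (N c)"
    using deviation_rare[OF N R n \<epsilon>] by blast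
  obtain K C where KC: "0 \<le> K" "0 < C"
      "\<And>c. (\<Sum>i\<in>{i. n i = 0}. real (N c i)) \<le> K"
      "\<And>c. 1 \<le> c \<Longrightarrow> (\<Sum>i\<in>UNIV. real (N c i)) \<le> C * real c"
      "\<And>c. 1 \<le> c \<Longrightarrow> spread (N c) \<le> C * real c"
    using tracks_bounds[OF N] by blast
  note C = KC(2,4)
  define d where "d = card (UNIV :: ('j \<times> 'i) set)"
  define g where "g c = C * exp M * (((C + 1) * real c) ^ d * exp (- \<eta> * real c))" for c
  have "g \<longlonglongrightarrow> 0"
    unfolding g_def by (rule tendsto_mult_right_zero[OF power_times_exp_neg_tendsto_0[OF \<eta>]])
  then have "eventually (\<lambda>c. g c < \<epsilon>) sequentially"
    using \<epsilon> by (rule order_tendstoD)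
  moreover have "eventually (\<lambda>c. 1 \<le> c) sequentially"
    by (rule eventually_ge_at_top)
  ultimately show "eventually (\<lambda>c. dist (mean_dev (N c) j i / real c) 0 < e) sequentially"
  proof eventually_elim
    case (elim c)
    then have c: "1 \<le> c" by simp
    let ?S = "states R (N c)"
    let ?h = "C * real c * (exp (M - \<eta> * real c) * B (N c))"
    have h: "0 \<le> ?h" using C(1) B_pos[of "N c"] by simp
    have term_le: "weight R mu m * \<bar>dev m j i\<bar> \<le> weight R mu m * (\<epsilon> * real c) + ?h" if m: "m \<in> ?S" for m
    proof (cases "\<epsilon> * real c < \<bar>dev m j i\<bar>")
      case True
      let ?q = "real (queue_length m j)"
      have q: "?q \<le> C * real c"
        using queue_length_le_real[OF m, of j] C(2)[OF c] by linarith
      have "m j i \<le> queue_length m j"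
        unfolding queue_length_def by (rule member_le_sum) (use R in auto)
      moreover have "0 \<le> Lam i / mu j i * ?q"
        using Lam_nonneg[of i] mu_pos[OF R] by simp
      moreover have "Lam i / mu j i * ?q \<le> 1 * ?q"
        by (rule mult_right_mono[OF ratio_le_1[OF R]]) simp
      ultimately have "\<bar>dev m j i\<bar> \<le> C * real c"
        using q unfolding dev_def by linarith
      then have "weight R mu m * \<bar>dev m j i\<bar> \<le> (exp (M - \<eta> * real c) * B (N c)) * (C * real c)"
        using rare[rule_format, OF c m True] weight_pos[of m] B_pos[of "N c"] by (intro mult_mono) auto
      moreover have "0 \<le> weight R mu m * (\<epsilon> * real c)"
        using weight_pos[of m] \<epsilon> by simp
      ultimately show ?thesis by (simp add: mult_ac)
    next
      case False
      then have "weight R mu m * \<bar>dev m j i\<bar> \<le> weight R mu m * (\<epsilon> * real c)"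
        using weight_pos[of m] by (intro mult_left_mono) auto
      then show ?thesis using h by linarith
    qed
    have "real (card ?S) \<le> real (((\<Sum>i\<in>UNIV. N c i) + 1) ^ d)"
      using finite_states_card(2)[of R "N c"] by (simp add: d_def flip: of_nat_power)
    also have "\<dots> = ((\<Sum>i\<in>UNIV. real (N c i)) + 1) ^ d"
      by (simp add: add.commute)
    also have "\<dots> \<le> ((C + 1) * real c) ^ d"
    proof (rule power_mono)
      show "(\<Sum>i\<in>UNIV. real (N c i)) + 1 \<le> (C + 1) * real c"
        using C(2)[OF c] c by (simp add: algebra_simps)
      show "0 \<le> (\<Sum>i\<in>UNIV. real (N c i)) + 1"
        by (simp add: sum_nonneg)
    qed
    finally have card: "real (card ?S) \<le> ((C + 1) * real c) ^ d" .
    have "(\<Sum>m\<in>?S. weight R mu m * \<bar>dev m j i\<bar>) \<le> (\<Sum>m\<in>?S. weight R mu m * (\<epsilon> * real c) + ?h)"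
      by (rule sum_mono) (rule term_le)
    also have "\<dots> = B (N c) * (\<epsilon> * real c) + real (card ?S) * ?h"
      by (simp add: sum.distrib normconst_def sum_distrib_right)
    also have "\<dots> \<le> B (N c) * (\<epsilon> * real c) + ((C + 1) * real c) ^ d * ?h"
      using mult_right_mono[OF card h] by simp
    also have "\<dots> = (\<epsilon> + g c) * (B (N c) * real c)"
      by (simp add: g_def algebra_simps exp_diff exp_minus divide_inverse)
    finally have "(\<Sum>m\<in>?S. weight R mu m * \<bar>dev m j i\<bar>) / (B (N c) * real c) \<le> \<epsilon> + g c"
      using B_pos[of "N c"] c by (simp add: pos_divide_le_eq)
    then have "mean_dev (N c) j i / real c \<le> \<epsilon> + g c"
      by (simp add: mean_dev_def)
    moreover have "0 \<le> mean_dev (N c) j i / real c"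
      unfolding mean_dev_def using B_pos[of "N c"] weight_pos
      by (intro divide_nonneg_nonneg sum_nonneg mult_nonneg_nonneg) (auto simp: less_imp_le)
    ultimately show ?case
      using elim by (simp add: \<epsilon>_def dist_real_def)
  qed
qed

subsection \<open>Limits of throughputs and marginals\<close>

lemma throughput_identity:
  assumes "N i \<noteq> 0"
  shows "(real (N i) - 1) * B (N(i := N i - 1))
    = (\<Sum>j\<in>{j. R j i}. mu j i * (\<Sum>m\<in>states R N. weight R mu m * (m j i / queue_length m j) * real (m j i - 1)))"
proof -
  let ?N = "N(i := N i - 1)"
  have N: "?N(i := Suc (?N i)) = N"
    using assms by auto
  have shift: "mu j i * (\<Sum>m\<in>states R N. weight R mu m * (m j i / queue_length m j) * real (m j i - 1))
      = (\<Sum>m\<in>states R ?N. weight R mu m * m j i)" if R: "R j i" for j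
    using sum_states_shift[OF R, where N = ?N and g = "\<lambda>m. real (m j i)"] mu_pos[OF R]
    unfolding N by (simp add: remove_customer_def)
  have "(\<Sum>j\<in>{j. R j i}. mu j i * (\<Sum>m\<in>states R N. weight R mu m * (m j i / queue_length m j) * real (m j i - 1)))
      = (\<Sum>j\<in>{j. R j i}. \<Sum>m\<in>states R ?N. weight R mu m * m j i)"
    by (rule sum.cong) (simp_all only: shift mem_Collect_eq)
  also have "\<dots> = (\<Sum>m\<in>states R ?N. weight R mu m * (\<Sum>j\<in>{j. R j i}. real (m j i)))"
    by (subst sum.swap) (simp add: sum_distrib_left)
  also have "\<dots> = (\<Sum>m\<in>states R ?N. weight R mu m * (real (N i) - 1))"
  proof (rule sum.cong)
    fix m assume m: "m \<in> states R ?N"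
    have "(\<Sum>j\<in>{j. R j i}. m j i) = (\<Sum>j\<in>UNIV. m j i)"
      by (rule sum.mono_neutral_left) (use m in \<open>auto simp: states_def\<close>)
    also have "\<dots> = N i - 1"
      using m by (simp add: states_def)
    finally have "real (\<Sum>j\<in>{j. R j i}. m j i) = real (N i) - 1"
      using assms by (simp only: of_nat_diff)
    then show "weight R mu m * (\<Sum>j\<in>{j. R j i}. real (m j i)) = weight R mu m * (real (N i) - 1)"
      by simp
  qed simp
  finally show ?thesis
    by (simp add: normconst_def mult.commute flip: sum_distrib_right)
qed

lemma throughput_error:
  assumes "N i \<noteq> 0"
  shows "\<bar>throughput i N - Lam i\<bar> * (real (N i) - 1)
    \<le> Lam i + (\<Sum>j\<in>{j. R j i}. mu j i * (mean_dev N j i + 1))"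
proof -
  let ?f = "\<lambda>j m. mu j i * (weight R mu m * (m j i / queue_length m j) * real (m j i - 1))"
  have term_le: "\<bar>?f j m - weight R mu m * (Lam i * m j i)\<bar> \<le> mu j i * (weight R mu m * (\<bar>dev m j i\<bar> + 1))"
    if R: "R j i" for j m
  proof (cases "m j i = 0")
    case True
    then show ?thesis
      using mu_pos[OF R] weight_pos[of m] by simp
  next
    case False
    have le: "m j i \<le> queue_length m j"
      unfolding queue_length_def by (rule member_le_sum) (use R in auto)
    then have q: "0 < real (queue_length m j)" using False by simp
    let ?r = "m j i / queue_length m j"
    have r: "0 \<le> ?r" "?r \<le> 1" using le q by auto
    have "?f j m - weight R mu m * (Lam i * m j i) = mu j i * (weight R mu m * (?r * (dev m j i - 1)))"
      using q mu_pos[OF R] False by (simp add: dev_def of_nat_diff field_simps)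
    also have "\<bar>\<dots>\<bar> = mu j i * (weight R mu m * (?r * \<bar>dev m j i - 1\<bar>))"
      using mu_pos[OF R] weight_pos[of m] r(1) by (simp add: abs_mult)
    also have "?r * \<bar>dev m j i - 1\<bar> \<le> 1 * (\<bar>dev m j i\<bar> + 1)"
      using r by (intro mult_mono) auto
    finally show ?thesis
      using mu_pos[OF R] weight_pos[of m] by (simp add: mult_left_mono)
  qed
  have Lam_sum: "(\<Sum>j\<in>{j. R j i}. \<Sum>m\<in>states R N. weight R mu m * (Lam i * m j i)) = Lam i * N i * B N"
  proof -
    have "(\<Sum>j\<in>{j. R j i}. \<Sum>m\<in>states R N. weight R mu m * (Lam i * m j i))
        = (\<Sum>m\<in>states R N. weight R mu m * (Lam i * real (\<Sum>j\<in>{j. R j i}. m j i)))"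
      by (subst sum.swap) (simp add: sum_distrib_left)
    also have "\<dots> = (\<Sum>m\<in>states R N. weight R mu m * (Lam i * N i))"
    proof (rule sum.cong)
      fix m assume m: "m \<in> states R N"
      have "(\<Sum>j\<in>{j. R j i}. m j i) = (\<Sum>j\<in>UNIV. m j i)"
        by (rule sum.mono_neutral_left) (use m in \<open>auto simp: states_def\<close>)
      also have "\<dots> = N i"
        using m by (simp add: states_def)
      finally show "weight R mu m * (Lam i * real (\<Sum>j\<in>{j. R j i}. m j i)) = weight R mu m * (Lam i * N i)"
        by (simp only:)
    qed simp
    also have "\<dots> = B N * (Lam i * N i)"
      unfolding normconst_def sum_distrib_right ..
    finally show ?thesis by (simp add: mult_ac)
  qed
  have mean: "(\<Sum>m\<in>states R N. mu j i * (weight R mu m * (\<bar>dev m j i\<bar> + 1))) = mu j i * (mean_dev N j i + 1) * B N" for j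
    using B_pos[of N]
    by (simp add: mean_dev_def normconst_def distrib_left distrib_right sum.distrib flip: sum_distrib_left)
  have eq: "(real (N i) - 1) * B (N(i := N i - 1)) - Lam i * N i * B N
      = (\<Sum>j\<in>{j. R j i}. \<Sum>m\<in>states R N. ?f j m - weight R mu m * (Lam i * m j i))"
    unfolding throughput_identity[of N i, OF assms] Lam_sum[symmetric] sum_subtractf
    by (simp add: sum_distrib_left)
  have "\<bar>(real (N i) - 1) * B (N(i := N i - 1)) - Lam i * N i * B N\<bar>
      \<le> (\<Sum>j\<in>{j. R j i}. \<Sum>m\<in>states R N. \<bar>?f j m - weight R mu m * (Lam i * m j i)\<bar>)"
    unfolding eq by (rule order_trans[OF sum_abs sum_mono[OF sum_abs]])
  also have "\<dots> \<le> (\<Sum>j\<in>{j. R j i}. \<Sum>m\<in>states R N. mu j i * (weight R mu m * (\<bar>dev m j i\<bar> + 1)))"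
    by (intro sum_mono term_le) simp
  also have "\<dots> = (\<Sum>j\<in>{j. R j i}. mu j i * (mean_dev N j i + 1)) * B N"
    unfolding mean by (simp add: sum_distrib_right)
  finally have "\<bar>(real (N i) - 1) * B (N(i := N i - 1)) - Lam i * N i * B N\<bar>
      \<le> (\<Sum>j\<in>{j. R j i}. mu j i * (mean_dev N j i + 1)) * B N" .
  moreover have "(real (N i) - 1) * B (N(i := N i - 1)) - Lam i * N i * B N
      = ((throughput i N - Lam i) * (real (N i) - 1) - Lam i) * B N"
    using assms B_pos[of N] by (simp add: throughput_def field_simps)
  ultimately have "\<bar>(throughput i N - Lam i) * (real (N i) - 1) - Lam i\<bar>
      \<le> (\<Sum>j\<in>{j. R j i}. mu j i * (mean_dev N j i + 1))"
    using B_pos[of N] by (simp add: abs_mult)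
  moreover have "\<bar>throughput i N - Lam i\<bar> * (real (N i) - 1) = \<bar>(throughput i N - Lam i) * (real (N i) - 1)\<bar>"
    using assms by (simp add: abs_mult)
  ultimately show ?thesis
    using Lam_nonneg[of i] by linarith
qed

lemma tracks_ratio:
  assumes "tracks N"
  shows "(\<lambda>c. (real (N c i) - 1) / real c) \<longlonglongrightarrow> n i"
proof -
  obtain K where K: "\<And>c i. \<bar>real (N c i) - real c * n i\<bar> \<le> K"
    using assms tracks_def by auto
  have "(\<lambda>c. (real (N c i) - 1) / real c - n i) \<longlonglongrightarrow> 0"
  proof (rule real_null_comparison)
    show "(\<lambda>c. (K + 1) / real c) \<longlonglongrightarrow> 0"
      by (rule lim_const_over_n)
    show "eventually (\<lambda>c. \<bar>(real (N c i) - 1) / real c - n i\<bar> \<le> (K + 1) / real c) sequentially"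
      using eventually_gt_at_top[of 0]
    proof eventually_elim
      case (elim c)
      have "(real (N c i) - 1) / real c - n i = (real (N c i) - real c * n i - 1) / real c"
        using elim by (simp add: field_simps)
      moreover have "\<bar>real (N c i) - real c * n i - 1\<bar> \<le> K + 1"
        using K[of c i] by linarith
      ultimately show ?case
        using elim by (simp add: divide_right_mono)
    qed
  qed
  then show ?thesis
    by (simp add: LIM_zero_iff)
qed

lemma throughput_tendsto_pos:
  assumes N: "tracks N" and n: "0 < n i"
  shows "(\<lambda>c. throughput i (N c)) \<longlonglongrightarrow> Lam i"
proof -
  define b where "b c = (Lam i + (\<Sum>j\<in>{j. R j i}. mu j i)) / real c
    + (\<Sum>j\<in>{j. R j i}. mu j i * (mean_dev (N c) j i / real c))" for c
  have "b \<longlonglongrightarrow> 0 + (\<Sum>j\<in>{j. R j i}. mu j i * 0)"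
    unfolding b_def
    by (intro tendsto_add tendsto_sum tendsto_mult tendsto_const lim_const_over_n)
      (simp add: mean_dev_sublinear[OF N _ n])
  then have "(\<lambda>c. b c / ((real (N c i) - 1) / real c)) \<longlonglongrightarrow> 0 / n i"
    using n by (intro tendsto_divide tracks_ratio[OF N]) auto
  then have lim: "(\<lambda>c. b c / ((real (N c i) - 1) / real c)) \<longlonglongrightarrow> 0" by simp
  have "eventually (\<lambda>c. 0 < (real (N c i) - 1) / real c) sequentially"
    using order_tendstoD(1)[OF tracks_ratio[OF N] n] .
  then have "eventually (\<lambda>c. \<bar>throughput i (N c) - Lam i\<bar> \<le> b c / ((real (N c i) - 1) / real c)) sequentially"
    using eventually_gt_at_top[of 0]
  proof eventually_elim
    case (elim c)
    then have N1: "0 < real (N c i) - 1" by (simp add: zero_less_divide_iff)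
    then have nz: "N c i \<noteq> 0" by (cases "N c i") auto
    have "b c * real c = Lam i + (\<Sum>j\<in>{j. R j i}. mu j i) + (\<Sum>j\<in>{j. R j i}. mu j i * mean_dev (N c) j i)"
      unfolding b_def distrib_right[of _ _ "real c"] sum_distrib_right using elim by simp
    also have "\<dots> = Lam i + (\<Sum>j\<in>{j. R j i}. mu j i * (mean_dev (N c) j i + 1))"
      by (simp add: distrib_left sum.distrib)
    finally have "b c * real c = Lam i + (\<Sum>j\<in>{j. R j i}. mu j i * (mean_dev (N c) j i + 1))" .
    then have "\<bar>throughput i (N c) - Lam i\<bar> * (real (N c i) - 1) \<le> b c * real c"
      using throughput_error[of "N c" i, OF nz] by simp
    then show ?case
      using N1 by (simp add: pos_le_divide_eq)
  qed
  then have "(\<lambda>c. throughput i (N c) - Lam i) \<longlonglongrightarrow> 0"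
    by (rule real_null_comparison[OF _ lim])
  then show ?thesis
    by (simp add: LIM_zero_iff)
qed

text \<open>A route with \<open>n i = 0\<close> crosses a saturated queue, whose capacity is used up in the limit by the
  routes with \<open>n k > 0\<close>.\<close>

lemma throughput_tendsto_zero:
  assumes N: "tracks N" and n: "n i = 0"
  shows "(\<lambda>c. throughput i (N c)) \<longlonglongrightarrow> 0"
proof -
  obtain j where R: "R j i" and load: "load j = 1"
    using tight_queue[OF n] by blast
  let ?P = "{k. R j k \<and> 0 < n k}"
  have upper: "throughput i M \<le> mu j i * (1 - (\<Sum>k\<in>?P. throughput k M / mu j k))" for M
  proof -
    have "throughput i M / mu j i + (\<Sum>k\<in>?P. throughput k M / mu j k)
        = (\<Sum>k\<in>insert i ?P. throughput k M / mu j k)"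
      using n by simp
    also have "\<dots> \<le> (\<Sum>k\<in>{k. R j k}. throughput k M / mu j k)"
      using R by (intro sum_mono2) (auto simp: throughput_nonneg mu_pos less_imp_le)
    also have "\<dots> \<le> 1"
      by (rule throughput_capacity)
    finally have "throughput i M / mu j i \<le> 1 - (\<Sum>k\<in>?P. throughput k M / mu j k)" by simp
    then show ?thesis
      using mu_pos[OF R] by (simp add: pos_divide_le_eq mult.commute)
  qed
  have "(\<Sum>k\<in>?P. Lam k / mu j k) = load j"
    unfolding load_def by (rule sum.mono_neutral_left) (auto simp: Lam_zero n_zero_iff)
  then have sum1: "(\<Sum>k\<in>?P. Lam k / mu j k) = 1" using load by simp
  have "(\<lambda>c. mu j i * (1 - (\<Sum>k\<in>?P. throughput k (N c) / mu j k)))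
      \<longlonglongrightarrow> mu j i * (1 - (\<Sum>k\<in>?P. Lam k / mu j k))"
    by (intro tendsto_mult tendsto_diff tendsto_sum tendsto_divide tendsto_const throughput_tendsto_pos[OF N])
      (use mu_pos in fastforce)+
  then have lim: "(\<lambda>c. mu j i * (1 - (\<Sum>k\<in>?P. throughput k (N c) / mu j k))) \<longlonglongrightarrow> 0"
    unfolding sum1 by simp
  show ?thesis
    by (rule real_null_comparison[OF _ lim]) (simp add: throughput_nonneg upper)
qed

lemma throughput_tendsto:
  assumes "tracks N"
  shows "(\<lambda>c. throughput i (N c)) \<longlonglongrightarrow> Lam i"
  using throughput_tendsto_pos[OF assms] throughput_tendsto_zero[OF assms] Lam_zero n_zero_iff
  by (cases "0 < n i") auto

definition shifted_const :: "'j set \<Rightarrow> ('i \<Rightarrow> nat) \<Rightarrow> ('i \<Rightarrow> nat) \<Rightarrow> real" where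
  "shifted_const A N k = (if \<forall>i. k i \<le> N i then restricted_const A (\<lambda>i. N i - k i) else 0)"

lemma shifted_const_Suc:
  "shifted_const A N (k(i := Suc (k i))) = (if \<forall>i. k i \<le> N i then
    if N i - k i = 0 then 0 else restricted_const A ((\<lambda>i. N i - k i)(i := N i - k i - 1)) else 0)"
proof -
  have 1: "(\<forall>l. (k(i := Suc (k i))) l \<le> N l) \<longleftrightarrow> (\<forall>l. k l \<le> N l) \<and> N i - k i \<noteq> 0"
  proof -
    have "(k(i := Suc (k i))) l \<le> N l \<longleftrightarrow> k l \<le> N l \<and> (l = i \<longrightarrow> N i - k i \<noteq> 0)" for l
      by auto
    then show ?thesis by blast
  qed
  have 2: "(\<lambda>l. N l - (k(i := Suc (k i))) l) = (\<lambda>i. N i - k i)(i := N i - k i - 1)"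
    by auto
  show ?thesis
    unfolding shifted_const_def 1 2 by auto
qed

lemma shifted_const_insert:
  assumes "j \<notin> A"
  shows "shifted_const (insert j A) N k
    = shifted_const A N k - (\<Sum>i\<in>{i. R j i}. shifted_const A N (k(i := Suc (k i))) / mu j i)"
proof (cases "\<forall>i. k i \<le> N i")
  case True
  show ?thesis
    unfolding shifted_const_Suc unfolding shifted_const_def if_P[OF True]
    by (rule restricted_const_rec[OF assms])
next
  case False
  show ?thesis
    unfolding shifted_const_Suc unfolding shifted_const_def if_not_P[OF False] by simp
qed

lemma shifted_const_empty_Suc:
  "shifted_const {} N (k(i := Suc (k i))) = shifted_const {} N k * throughput i (\<lambda>i. N i - k i)"
  unfolding shifted_const_Suc using B_pos[of "\<lambda>i. N i - k i"]
  by (simp add: shifted_const_def throughput_def)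

lemma shifted_const_empty_tendsto:
  assumes N: "tracks N"
  shows "(\<lambda>c. shifted_const {} (N c) k / B (N c)) \<longlonglongrightarrow> (\<Prod>i\<in>UNIV. Lam i ^ k i)"
proof (induction "\<Sum>i\<in>UNIV. k i" arbitrary: k)
  case 0
  then have k: "k = (\<lambda>_. 0)" by auto
  have eq: "shifted_const {} (N c) k / B (N c) = 1" for c
    using B_pos[of "N c"] by (simp add: k shifted_const_def)
  show ?case
    unfolding eq by (simp add: k)
next
  case (Suc t)
  then obtain i where i: "k i \<noteq> 0"
    by (metis nat.distinct(1) sum.neutral)
  define k' where "k' = k(i := k i - 1)"
  have k: "k = k'(i := Suc (k' i))"
    using i by (auto simp: k'_def)
  have "t = (\<Sum>i\<in>UNIV. k' i)"
    using Suc.hyps(2) sum_decrement[of k i] i by (simp add: k'_def)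
  then have "(\<lambda>c. shifted_const {} (N c) k' / B (N c)) \<longlonglongrightarrow> (\<Prod>i\<in>UNIV. Lam i ^ k' i)"
    by (rule Suc.hyps(1))
  then have "(\<lambda>c. shifted_const {} (N c) k' / B (N c) * throughput i (\<lambda>i. N c i - k' i))
      \<longlonglongrightarrow> (\<Prod>i\<in>UNIV. Lam i ^ k' i) * Lam i"
    by (intro tendsto_mult throughput_tendsto tracks_diff N)
  moreover have "(\<Prod>l\<in>UNIV. Lam l ^ k l) = (\<Prod>l\<in>UNIV. Lam l ^ k' l) * Lam i"
  proof -
    have "Lam l ^ k l = Lam l ^ k' l * (if l = i then Lam i else 1)" for l
      by (simp add: k)
    then show ?thesis
      by (simp add: prod.distrib)
  qed
  moreover have "shifted_const {} M k = shifted_const {} M k' * throughput i (\<lambda>i. M i - k' i)" for M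
    unfolding k by (rule shifted_const_empty_Suc)
  ultimately show ?case
    by simp
qed

lemma shifted_const_tendsto:
  assumes N: "tracks N"
  shows "(\<lambda>c. shifted_const A (N c) k / B (N c)) \<longlonglongrightarrow> (\<Prod>j\<in>A. 1 - load j) * (\<Prod>i\<in>UNIV. Lam i ^ k i)"
  using finite[of A]
proof (induction A arbitrary: k rule: finite_induct)
  case empty
  then show ?case
    using shifted_const_empty_tendsto[OF N] by simp
next
  case (insert j A)
  let ?P = "\<Prod>j\<in>A. 1 - load j" and ?L = "\<lambda>k. \<Prod>i\<in>UNIV. Lam i ^ k i"
  have L: "?L (k(i := Suc (k i))) = ?L k * Lam i" for i
  proof -
    have "Lam l ^ (k(i := Suc (k i))) l = Lam l ^ k l * (if l = i then Lam i else 1)" for l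
      by simp
    then show ?thesis
      by (simp add: prod.distrib)
  qed
  have "(\<lambda>c. shifted_const A (N c) k / B (N c)
        - (\<Sum>i\<in>{i. R j i}. shifted_const A (N c) (k(i := Suc (k i))) / B (N c) / mu j i))
      \<longlonglongrightarrow> ?P * ?L k - (\<Sum>i\<in>{i. R j i}. ?P * ?L (k(i := Suc (k i))) / mu j i)"
    by (intro tendsto_diff tendsto_sum tendsto_divide tendsto_const insert.IH) (use mu_pos in fastforce)
  moreover have "?P * ?L k - (\<Sum>i\<in>{i. R j i}. ?P * ?L (k(i := Suc (k i))) / mu j i)
      = (\<Prod>j\<in>insert j A. 1 - load j) * ?L k"
  proof -
    have "(\<Sum>i\<in>{i. R j i}. ?P * ?L (k(i := Suc (k i))) / mu j i) = ?P * ?L k * load j"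
      unfolding L load_def sum_distrib_left by (rule sum.cong) simp_all
    then show ?thesis
      using insert.hyps by (simp add: algebra_simps)
  qed
  moreover have "shifted_const (insert j A) M k / b = shifted_const A M k / b
        - (\<Sum>i\<in>{i. R j i}. shifted_const A M (k(i := Suc (k i))) / b / mu j i)" for M b
    unfolding shifted_const_insert[OF insert.hyps(2)] diff_divide_distrib sum_divide_distrib
    by (simp add: mult.commute)
  ultimately show ?case by simp
qed

lemma marginal_weight:
  assumes mo: "\<And>j i. mo j i \<noteq> 0 \<Longrightarrow> j \<in> Jo \<and> R j i"
  shows "(\<Sum>m\<in>{m\<in>states R N. \<forall>j\<in>Jo. \<forall>i. m j i = mo j i}. weight R mu m)
    = (\<Prod>j\<in>Jo. queue_weight j (mo j)) * shifted_const Jo N (\<lambda>i. \<Sum>j\<in>UNIV. mo j i)"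
proof -
  let ?k = "\<lambda>i. \<Sum>j\<in>UNIV. mo j i"
  let ?S = "{m\<in>states R N. \<forall>j\<in>Jo. \<forall>i. m j i = mo j i}"
  have ge: "mo j i \<le> m j i" if "m \<in> ?S" for m j i
    using that mo by (metis (mono_tags, lifting) le_eq_less_or_eq mem_Collect_eq zero_le)
  show ?thesis
  proof (cases "\<forall>i. ?k i \<le> N i")
    case False
    then obtain i where i: "N i < ?k i" by (meson not_le)
    have "m \<notin> ?S" for m
    proof
      assume m: "m \<in> ?S"
      have "?k i \<le> (\<Sum>j\<in>UNIV. m j i)"
        by (rule sum_mono) (rule ge[OF m])
      also have "\<dots> = N i" using m by (simp add: states_def)
      finally show False using i by simp
    qed
    then have "?S = {}" by blast
    then show ?thesis
      using False by (simp only: shifted_const_def) simp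
  next
    case True
    let ?N = "\<lambda>i. N i - ?k i"
    let ?S' = "{m\<in>states R ?N. \<forall>j\<in>Jo. \<forall>i. m j i = 0}"
    have split: "weight R mu m = (\<Prod>j\<in>Jo. queue_weight j (m j)) * (\<Prod>j\<in>- Jo. queue_weight j (m j))" for m
      unfolding weight_eq by (subst prod.union_disjoint[symmetric]) (auto simp: Un_commute)
    have qw0: "queue_weight j (\<lambda>_. 0) = 1" for j
      by (simp add: queue_weight_def)
    have out: "mo j = (\<lambda>_. 0)" if "j \<notin> Jo" for j
      using mo that by blast
    have "(\<Sum>m\<in>?S. weight R mu m) = (\<Sum>m\<in>?S'. (\<Prod>j\<in>Jo. queue_weight j (mo j)) * weight R mu m)"
    proof (rule sum.reindex_bij_witness[where j = "\<lambda>m j i. m j i - mo j i" and i = "\<lambda>m j i. m j i + mo j i"])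
      fix m assume m: "m \<in> ?S"
      let ?m = "\<lambda>j i. m j i - mo j i"
      show "(\<lambda>j i. ?m j i + mo j i) = m"
        using ge[OF m] by simp
      have "(\<Sum>j\<in>UNIV. ?m j i) = N i - ?k i" for i
        using m by (subst sum_subtractf_nat) (auto simp: ge[OF m] states_def)
      then show "?m \<in> ?S'"
        using m by (auto simp: states_def)
      have "(\<Prod>j\<in>Jo. queue_weight j (m j)) = (\<Prod>j\<in>Jo. queue_weight j (mo j))"
      proof (rule prod.cong)
        fix j assume "j \<in> Jo"
        then have "m j = mo j" using m by blast
        then show "queue_weight j (m j) = queue_weight j (mo j)" by simp
      qed simp
      moreover have "(\<Prod>j\<in>Jo. queue_weight j (?m j)) = 1"
      proof (rule prod.neutral, rule ballI)
        fix j assume "j \<in> Jo"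
        then have "?m j = (\<lambda>_. 0)" using m by auto
        then show "queue_weight j (?m j) = 1" by (simp only: qw0)
      qed
      moreover have "(\<Prod>j\<in>- Jo. queue_weight j (?m j)) = (\<Prod>j\<in>- Jo. queue_weight j (m j))"
        by (rule prod.cong) (auto simp: out)
      ultimately show "(\<Prod>j\<in>Jo. queue_weight j (mo j)) * weight R mu ?m = weight R mu m"
        by (simp add: split)
    next
      fix m assume m: "m \<in> ?S'"
      show "(\<lambda>j i. (m j i + mo j i) - mo j i) = m" by simp
      have "(\<Sum>j\<in>UNIV. m j i + mo j i) = N i" for i
        using m True by (simp add: sum.distrib states_def)
      then show "(\<lambda>j i. m j i + mo j i) \<in> ?S"
        using m mo by (auto simp: states_def)
    qed
    also have "\<dots> = (\<Prod>j\<in>Jo. queue_weight j (mo j)) * (\<Sum>m\<in>?S'. weight R mu m)"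
      by (simp add: sum_distrib_left)
    also have "(\<Sum>m\<in>?S'. weight R mu m) = restricted_const Jo ?N"
      unfolding restricted_const_def
      by (simp add: sum.inter_filter finite_states_card of_bool_def if_distrib cong: if_cong)
    finally show ?thesis
      using True by (simp only: shifted_const_def) simp
  qed
qed

lemma marginal_tendsto:
  assumes N: "tracks N" and mo: "\<And>j i. mo j i \<noteq> 0 \<Longrightarrow> j \<in> Jo \<and> R j i"
  shows "(\<lambda>c. marginal_pi R mu Jo (N c) mo) \<longlonglongrightarrow> open_pi R mu Jo Lam mo"
proof -
  let ?k = "\<lambda>i. \<Sum>j\<in>UNIV. mo j i"
  let ?w = "\<Prod>j\<in>Jo. queue_weight j (mo j)"
  have "marginal_pi R mu Jo M mo = ?w * (shifted_const Jo M ?k / B M)" for M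
    unfolding marginal_pi_def closed_pi_def sum_divide_distrib[symmetric]
    using marginal_weight[of mo Jo, OF mo] by simp
  moreover have "(\<lambda>c. ?w * (shifted_const Jo (N c) ?k / B (N c)))
      \<longlonglongrightarrow> ?w * ((\<Prod>j\<in>Jo. 1 - load j) * (\<Prod>i\<in>UNIV. Lam i ^ ?k i))"
    by (intro tendsto_mult tendsto_const shifted_const_tendsto[OF N])
  moreover have "?w * ((\<Prod>j\<in>Jo. 1 - load j) * (\<Prod>i\<in>UNIV. Lam i ^ ?k i)) = open_pi R mu Jo Lam mo"
  proof -
    have "(\<Prod>i\<in>UNIV. Lam i ^ ?k i) = (\<Prod>j\<in>UNIV. \<Prod>i\<in>UNIV. Lam i ^ mo j i)"
      unfolding power_sum by (rule prod.swap)
    also have "\<dots> = (\<Prod>j\<in>Jo. \<Prod>i\<in>UNIV. Lam i ^ mo j i)"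
    proof (rule prod.mono_neutral_right)
      show "\<forall>j\<in>UNIV - Jo. (\<Prod>i\<in>UNIV. Lam i ^ mo j i) = 1"
      proof
        fix j assume "j \<in> UNIV - Jo"
        then have "mo j i = 0" for i
          using mo by blast
        then show "(\<Prod>i\<in>UNIV. Lam i ^ mo j i) = 1" by simp
      qed
    qed auto
    also have "\<dots> = (\<Prod>j\<in>Jo. \<Prod>i\<in>{i. R j i}. Lam i ^ mo j i)"
    proof (rule prod.cong)
      show "(\<Prod>i\<in>UNIV. Lam i ^ mo j i) = (\<Prod>i\<in>{i. R j i}. Lam i ^ mo j i)" for j
        by (rule prod.mono_neutral_right) (use mo in force)+
    qed simp
    finally have "?w * ((\<Prod>j\<in>Jo. 1 - load j) * (\<Prod>i\<in>UNIV. Lam i ^ ?k i))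
        = (\<Prod>j\<in>Jo. queue_weight j (mo j) * ((1 - load j) * (\<Prod>i\<in>{i. R j i}. Lam i ^ mo j i)))"
      by (simp add: prod.distrib)
    also have "\<dots> = open_pi R mu Jo Lam mo"
      unfolding open_pi_def queue_weight_def load_def
    proof (rule prod.cong)
      fix j
      have regroup: "a * x * (b * y) = b * a * z" if "x * y = z" for a b x y z :: real
        unfolding that[symmetric] by simp
      have "(\<Prod>i\<in>{i. R j i}. (1 / mu j i) ^ mo j i) * (\<Prod>i\<in>{i. R j i}. Lam i ^ mo j i)
          = (\<Prod>i\<in>{i. R j i}. (Lam i / mu j i) ^ mo j i)"
        by (simp add: power_divide flip: prod.distrib)
      then show "fact (\<Sum>i\<in>{i. R j i}. mo j i) / (\<Prod>i\<in>{i. R j i}. fact (mo j i)) * (\<Prod>i\<in>{i. R j i}. (1 / mu j i) ^ mo j i)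
          * ((1 - (\<Sum>i\<in>{i. R j i}. Lam i / mu j i)) * (\<Prod>i\<in>{i. R j i}. Lam i ^ mo j i))
        = (1 - (\<Sum>i\<in>{i. R j i}. Lam i / mu j i)) * (fact (\<Sum>i\<in>{i. R j i}. mo j i) / (\<Prod>i\<in>{i. R j i}. fact (mo j i)))
          * (\<Prod>i\<in>{i. R j i}. (Lam i / mu j i) ^ mo j i)"
        by (rule regroup)
    qed simp
    finally show ?thesis .
  qed
  ultimately show ?thesis by simp
qed

end

theorem theorem1:
  fixes R :: "'j::finite \<Rightarrow> 'i::finite \<Rightarrow> bool"
    and mu :: "'j \<Rightarrow> 'i \<Rightarrow> real"
    and n :: "'i \<Rightarrow> real"
    and Lam :: "'i \<Rightarrow> real"
    and u :: "nat \<Rightarrow> 'i \<Rightarrow> real"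
    and mo :: "'j \<Rightarrow> 'i \<Rightarrow> nat"
  assumes routes_nonempty: "\<forall>i. \<exists>j. R j i"
    and mu_pos: "\<forall>j i. R j i \<longrightarrow> 0 < mu j i"
    and n_nonneg: "\<forall>i. 0 \<le> n i"
    and opt: "is_optimizer R mu n Lam"
    and opt_unique: "\<forall>L. is_optimizer R mu n L \<longrightarrow> L = Lam"
    and u_bounded: "\<exists>K. \<forall>c i. \<bar>u c i\<bar> \<le> K"
    and u_int: "\<forall>c i. real c * n i + u c i \<in> \<nat>"
    and mo_support: "\<forall>j i. mo j i \<noteq> 0 \<longrightarrow> j \<in> nonbottleneck R mu Lam \<and> R j i"
  shows "(\<lambda>c. marginal_pi R mu (nonbottleneck R mu Lam)
              (\<lambda>i. nat \<lfloor>real c * n i + u c i\<rfloor>) mo)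
         \<longlonglongrightarrow> open_pi R mu (nonbottleneck R mu Lam) Lam mo"
proof -
  interpret optimal_network R mu n Lam
    by unfold_locales (use routes_nonempty mu_pos n_nonneg opt opt_unique in blast)+
  have "real (nat \<lfloor>real c * n i + u c i\<rfloor>) = real c * n i + u c i" for c i
  proof -
    obtain k where "real c * n i + u c i = real k"
      using u_int by (metis Nats_cases)
    then show ?thesis by simp
  qed
  then have "tracks (\<lambda>c i. nat \<lfloor>real c * n i + u c i\<rfloor>)"
    using u_bounded by (simp add: tracks_def)
  then show ?thesis
    by (rule marginal_tendsto) (use mo_support in blast)
qed

end
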